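(* Let $A\in\mathscr{R}$ be a fixed set. In the risk model described in the context, suppose that the claim vectors $\{\mathbf{X}^{(i)}, i\in\mathbb{N}\}$ are identically distributed with common distribution $F$ supported on the nonnegative quadrant; that $\{\mathbf{X}^{(i)}, i\in\mathbb{N}\}$, $\{N(t), t\ge 0\}$ and $\{\xi(t), t\ge 0\}$ are mutually independent; that for any $T\in\varLambda\setminus\{\infty\}$ there exists a positive constant $K_T$ such that $\mathbf{P}\left[\inf_{0\le t\le T}\xi(t)\ge -K_T\right]=1$; that $\{\mathbf{X}^{(i)}, i\in\mathbb{N}\}$ are quasi-asymptotically independent on $A$ ($QAI_A$); and that $F\in\mathcal{C}_A$. If $F\in MRV_{-\alpha}(\mu,G)$ (with $\alpha\in(0,\infty)$), then for any fixed $T\in\varLambda\setminus\{\infty\}$, as $x\to\infty$, $$\mathbf{P}\left[\mathbf{D}(T)\in xA\right]\sim\mu(A)\,\overline{G}(x)\int_0^T\mathbf{E}\left[e^{-\alpha\,\xi(s)}\right]\lambda(ds).$$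
   Context: Risk model. Fix $d\in\mathbb{N}$. The claim vectors $\mathbf{X}^{(i)}=(X^{(i)}_1,\dots,X^{(i)}_d)^\top$, $i\in\mathbb{N}$, are identically distributed copies of a random vector $\mathbf{X}$ with distribution $F$ supported on $[0,\infty)^d$; a claim vector may have zero components but is not the zero vector. They are not assumed independent of each other, and the components of each vector may be arbitrarily dependent. Claims arrive at random times $\{\tau_i, i\in\mathbb{N}\}$ forming a renewal counting process $N(t)=\sup\{i\in\mathbb{N}:\tau_i\le t\}$, $t\ge 0$ (with $\sup\emptyset=0$), i.e. $\tau_i$ are the partial sums of i.i.d. nonnegative inter-arrival times (not a.s. zero). Its renewal function $\lambda(t)=\mathbf{E}[N(t)]=\sum_{i\ge1}\mathbf{P}[\tau_i\le t]$ is finite for finite $t$, and $\lambda(ds)=\sum_{i\ge 1}\mathbf{P}[\tau_i\in ds]$ is the renewal measure. Put $\varLambda=\{t\ge 0: 0<\lambda(t)\le\infty\}$ (allowing $t=\infty$). $\{\xi(t),t\ge0\}$ is a real-valued càdlàg stochastic process with $\xi(0)=0$. The discounted aggregate claim vector is $\mathbf{D}(T)=\sum_{i=1}^{N(T)}\mathbf{X}^{(i)}e^{-\xi(\tau_i)}$. Sets. A set $B\subset\mathbb{R}^d$ is increasing if $\mathbf{x}+\mathbf{y}\in B$ for all $\mathbf{x}\in B$ and $\mathbf{y}\in[0,\infty)^d$. $\mathscr{R}$ is the family of all $A\subset\mathbb{R}^d$ that are open, increasing, with convex complement $A^c$, and with $\mathbf{0}\notin\overline{A}$. Reduction to one dimension.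 For a random vector $\mathbf{Z}$ supported on $[0,\infty)^d$ with distribution $V$ and $A\in\mathscr{R}$, put $Z_A=\sup\{u:\mathbf{Z}\in uA\}$ (with $\sup\emptyset=0$); its distribution $V_A$ satisfies $\overline{V_A}(x)=\mathbf{P}[Z_A>x]=\mathbf{P}[\mathbf{Z}\in xA]$ for $x>0$. Here $\overline{G}=1-G$ denotes the tail of a distribution $G$. Class $\mathcal{C}_A$. A distribution $G$ on $[0,\infty)$ with $\overline G(x)>0$ for all $x\ge0$ is consistently varying, $G\in\mathcal{C}$, if $\lim_{b\uparrow1}\limsup_{x\to\infty}\overline{G}(bx)/\overline{G}(x)=1$. $V\in\mathcal{C}_A$ means $V_A\in\mathcal{C}$. Multivariate regular variation. A distribution $G$ on $[0,\infty)$ with everywhere positive tail is in $\mathcal{R}_{-\alpha}$, $\alpha\in(0,\infty)$, if $\overline{G}(yx)\sim y^{-\alpha}\overline{G}(x)$ as $x\to\infty$ for every $y>0$. The distribution $V$ of a random vector $\mathbf{Z}$ on $[0,\infty)^d$ is in $MRV_{-\alpha}(\mu,G)$ if $G\in\mathcal{R}_{-\alpha}$ and $\mu$ is a Radon measure, not identically zero, with $\lim_{x\to\infty}\mathbf{P}[\mathbf{Z}\in xB]/\overline{G}(x)=\mu(B)$ for every Borel set $B\subsetneq[0,\infty]^d$ bounded away from $\mathbf{0}$ with $\mu(\partial B)=0$. Since $\mu$ lives on the nonnegative quadrant, $\mu(A)$ means $\mu(A\cap[0,\infty)^d)$. Dependence. Nonnegative random variables $\{Z_i,i\ge1\}$ with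 distributions $V_1,V_2,\dots$ are quasi-asymptotically independent (QAI) if $\lim_{x\to\infty}\mathbf{P}[Z_i>x,\,Z_j>x]/(\overline{V_i}(x)+\overline{V_j}(x))=0$ for all $i\ne j$. Nonnegative random vectors $\{\mathbf{Z}^{(i)},i\in\mathbb{N}\}$ are $QAI_A$ if the random variables $Z_A^{(i)}=\sup\{u:\mathbf{Z}^{(i)}\in uA\}$, $i\in\mathbb{N}$, are QAI.
   Formalization: When μ(A)=0 (which the hypotheses allow) the right-hand side vanishes identically while the left is positive, so "~" has no meaning as a ratio; in that case the formal theorem states P[D(T)∈xA]=o(Ḡ(x)), and for μ(A)≠0 it states the equivalence as written. *)

theory Defs
  imports "HOL-Probability.Probability" "HOL-Library.Landau_Symbols"
begin

section \<open>Distributions on the half-line\<close>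

definition tail :: "real measure \<Rightarrow> real \<Rightarrow> real" where
  "tail G x = 1 - cdf G x"

definition halfline_distribution :: "real measure \<Rightarrow> bool" where
  "halfline_distribution G \<longleftrightarrow>
     real_distribution G \<and> (AE x in G. 0 \<le> x) \<and> (\<forall>x\<ge>0. 0 < tail G x)"

text \<open>The class \<open>\<C>\<close>; the inner upper limit may be infinite and is taken in the extended reals.\<close>

definition consistently_varying :: "real measure \<Rightarrow> bool" where
  "consistently_varying G \<longleftrightarrow> halfline_distribution G \<and>
     ((\<lambda>b. Limsup at_top (\<lambda>x. ereal (tail G (b * x) / tail G x))) \<longlongrightarrow> 1) (at_left 1)"

definition regularly_varying :: "real \<Rightarrow> real measure \<Rightarrow> bool" where
  "regularly_varying \<alpha> G \<longleftrightarrow> halfline_distribution G \<and>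
     (\<forall>y>0. (\<lambda>x. tail G (y * x)) \<sim>[at_top] (\<lambda>x. y powr (-\<alpha>) * tail G x))"


section \<open>The sets and the reduction to one dimension\<close>

definition quadrant :: "(real ^ 'd) set" where
  "quadrant = {x. \<forall>j. 0 \<le> x $ j}"

definition increasing_set :: "(real ^ 'd) set \<Rightarrow> bool" where
  "increasing_set B \<longleftrightarrow> (\<forall>x\<in>B. \<forall>y\<in>quadrant. x + y \<in> B)"

definition class_R :: "(real ^ 'd) set set" where
  "class_R = {A. open A \<and> increasing_set A \<and> convex (- A) \<and> 0 \<notin> closure A}"

text \<open>For \<open>A\<close> in \<open>class_R\<close> and \<open>z\<close> in the quadrant the set of all \<open>u\<close> is bounded above and has no
  negative elements. The case distinction gives the supremum of the empty set the value \<open>0\<close>.\<close>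

definition reduct :: "(real ^ 'd) set \<Rightarrow> real ^ 'd \<Rightarrow> real" where
  "reduct A z = (let S = {u. z \<in> (\<lambda>a. u *\<^sub>R a) ` A} in if S = {} then 0 else Sup S)"

definition class_C :: "(real ^ 'd) set \<Rightarrow> (real ^ 'd) measure set" where
  "class_C A = {V. consistently_varying (distr V borel (reduct A))}"


section \<open>Multivariate regular variation\<close>

text \<open>The compactified quadrant \<open>[0,\<infinity>]\<^sup>d\<close> is the type \<^typ>\<open>ennreal ^ 'd\<close> with its
  product topology. The limit measure is a Borel measure on this space without the origin, which
  is locally compact and second countable, so that a Radon measure is a Borel measure that is
  finite on compact sets.\<close>

definition radon_punctured :: "(ennreal ^ 'd) measure \<Rightarrow> bool" where
  "radon_punctured \<mu> \<longleftrightarrow> sets \<mu> = sets (restrict_space borel (- {0})) \<and>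
     (\<forall>K. compact K \<and> 0 \<notin> K \<longrightarrow> emeasure \<mu> K < \<infinity>)"

definition embed :: "real ^ 'd \<Rightarrow> ennreal ^ 'd" where
  "embed z = (\<chi> j. ennreal (z $ j))"

definition dilate :: "real \<Rightarrow> (ennreal ^ 'd) set \<Rightarrow> (ennreal ^ 'd) set" where
  "dilate x B = (\<lambda>b. \<chi> j. ennreal x * b $ j) ` B"

text \<open>\<^const>\<open>embed\<close> sends negative components to \<open>0\<close>, so \<open>V\<close> is required to live on the
  quadrant. A set bounded away from the origin is a proper subset of the whole space.\<close>

definition MRV :: "real \<Rightarrow> (ennreal ^ 'd) measure \<Rightarrow> real measure \<Rightarrow> (real ^ 'd) measure set" where
  "MRV \<alpha> \<mu> G = {V. (AE z in V. z \<in> quadrant) \<and> regularly_varying \<alpha> G \<and>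
     radon_punctured \<mu> \<and> emeasure \<mu> (space \<mu>) \<noteq> 0 \<and>
     (\<forall>B \<in> sets borel. 0 \<notin> closure B \<and> emeasure \<mu> (frontier B) = 0 \<longrightarrow>
        ((\<lambda>x. measure V {z. embed z \<in> dilate x B} / tail G x) \<longlongrightarrow> measure \<mu> B) at_top)}"

definition quadrant_measure :: "(ennreal ^ 'd) measure \<Rightarrow> (real ^ 'd) set \<Rightarrow> real" where
  "quadrant_measure \<mu> A = measure \<mu> (embed ` (A \<inter> quadrant))"


section \<open>Dependence\<close>

definition QAI :: "'a measure \<Rightarrow> (nat \<Rightarrow> 'a \<Rightarrow> real) \<Rightarrow> bool" where
  "QAI M Z \<longleftrightarrow> (\<forall>i\<ge>1. \<forall>j\<ge>1. i \<noteq> j \<longrightarrow>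
     ((\<lambda>x. measure M {\<omega> \<in> space M. Z i \<omega> > x \<and> Z j \<omega> > x} /
           (tail (distr M borel (Z i)) x + tail (distr M borel (Z j)) x)) \<longlongrightarrow> 0) at_top)"

definition QAI_on :: "(real ^ 'd) set \<Rightarrow> 'a measure \<Rightarrow> (nat \<Rightarrow> 'a \<Rightarrow> real ^ 'd) \<Rightarrow> bool" where
  "QAI_on A M Z \<longleftrightarrow> QAI M (\<lambda>i \<omega>. reduct A (Z i \<omega>))"

definition process_events ::
    "'a measure \<Rightarrow> 'b measure \<Rightarrow> 'i set \<Rightarrow> ('i \<Rightarrow> 'a \<Rightarrow> 'b) \<Rightarrow> 'a set set" where
  "process_events M M' I Z =
     sigma_sets (space M) {Z i -` S \<inter> space M | i S. i \<in> I \<and> S \<in> sets M'}"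


section \<open>The risk model\<close>

text \<open>The inter-arrival times are \<open>\<theta> 1, \<theta> 2, \<dots>\<close>.\<close>

definition arrival :: "(nat \<Rightarrow> 'a \<Rightarrow> real) \<Rightarrow> nat \<Rightarrow> 'a \<Rightarrow> real" where
  "arrival \<theta> i \<omega> = (\<Sum>k=1..i. \<theta> k \<omega>)"

text \<open>The count is extended-valued because it may be infinite on a null set; the supremum of the
  empty set in \<^typ>\<open>enat\<close> is \<open>0\<close>.\<close>

definition claim_count :: "(nat \<Rightarrow> 'a \<Rightarrow> real) \<Rightarrow> real \<Rightarrow> 'a \<Rightarrow> enat" where
  "claim_count \<theta> t \<omega> = Sup (enat ` {i. 1 \<le> i \<and> arrival \<theta> i \<omega> \<le> t})"

definition renewal_fun :: "'a measure \<Rightarrow> (nat \<Rightarrow> 'a \<Rightarrow> real) \<Rightarrow> real \<Rightarrow> ennreal" where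
  "renewal_fun M \<theta> t = (\<integral>\<^sup>+ \<omega>. ennreal_of_enat (claim_count \<theta> t \<omega>) \<partial>M)"

definition renewal_measure :: "'a measure \<Rightarrow> (nat \<Rightarrow> 'a \<Rightarrow> real) \<Rightarrow> real measure" where
  "renewal_measure M \<theta> = measure_of UNIV (sets borel)
     (\<lambda>B. \<Sum>i. emeasure (distr M borel (arrival \<theta> (Suc i))) B)"

text \<open>\<open>\<Lambda> \ {\<infinity>}\<close>.\<close>

definition finite_horizons :: "'a measure \<Rightarrow> (nat \<Rightarrow> 'a \<Rightarrow> real) \<Rightarrow> real set" where
  "finite_horizons M \<theta> = {t. 0 \<le> t \<and> 0 < renewal_fun M \<theta> t}"

definition cadlag :: "(real \<Rightarrow> real) \<Rightarrow> bool" where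
  "cadlag f \<longleftrightarrow> (\<forall>t\<ge>0. continuous (at_right t) f) \<and> (\<forall>t>0. \<exists>l. (f \<longlongrightarrow> l) (at_left t))"

definition discounted_claims ::
    "(nat \<Rightarrow> 'a \<Rightarrow> real ^ 'd) \<Rightarrow> (nat \<Rightarrow> 'a \<Rightarrow> real) \<Rightarrow> (real \<Rightarrow> 'a \<Rightarrow> real) \<Rightarrow> real \<Rightarrow> 'a \<Rightarrow> real ^ 'd"
  where
  "discounted_claims X \<theta> \<xi> T \<omega> =
     (\<Sum>i | 1 \<le> i \<and> enat i \<le> claim_count \<theta> T \<omega>. exp (- \<xi> (arrival \<theta> i \<omega>) \<omega>) *\<^sub>R X i \<omega>)"

definition renewal_interarrivals :: "'a measure \<Rightarrow> (nat \<Rightarrow> 'a \<Rightarrow> real) \<Rightarrow> bool" where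
  "renewal_interarrivals M \<theta> \<longleftrightarrow>
     prob_space.indep_vars M (\<lambda>_. borel) \<theta> {1..} \<and>
     (\<forall>i\<ge>1. distr M borel (\<theta> i) = distr M borel (\<theta> 1)) \<and>
     (\<forall>i\<ge>1. \<forall>\<omega>\<in>space M. 0 \<le> \<theta> i \<omega>) \<and>
     \<not> (AE \<omega> in M. \<theta> 1 \<omega> = 0)"

text \<open>Mutual independence of the claims, the counting process and the process \<open>\<xi>\<close>. The three
  families have different value types, so independence is stated for the generated
  \<open>\<sigma>\<close>-algebras.\<close>

definition independent_model ::
    "'a measure \<Rightarrow> (nat \<Rightarrow> 'a \<Rightarrow> real ^ 'd) \<Rightarrow> (nat \<Rightarrow> 'a \<Rightarrow> real) \<Rightarrow> (real \<Rightarrow> 'a \<Rightarrow> real) \<Rightarrow> bool"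
  where
  "independent_model M X \<theta> \<xi> \<longleftrightarrow> prob_space.indep_sets M
     (\<lambda>k. [process_events M borel {1..} X,
           process_events M (count_space UNIV) {0..} (claim_count \<theta>),
           process_events M borel {0..} \<xi>] ! k) {..<3}"

end

theory Submission
  imports Defs
begin

text \<open>For \<open>A\<close> in the class, \<^const>\<open>reduct\<close> \<open>A\<close> is a monotone sublinear functional on the quadrant,
  so almost surely its value at the discounted aggregate claim lies between the maximum and the sum
  of the discounted one-dimensional claims. Conditionally on arrivals and returns the discount
  factors are constants; quasi-asymptotic independence then makes the tails of the maximum and of
  the sum agree with the sum of the individual tails, which regular variation evaluates. A Potter
  bound for the class \<open>\<C>\<close> dominates the conditional ratio by a power of the number of claims. This
  power is integrable because the arrival times satisfy a Chernoff bound, so dominated convergence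
  removes the conditioning. If \<open>\<mu>(A) = 0\<close>, the domination alone gives the result.\<close>

section \<open>Reduction to one dimension\<close>

text \<open>Multivariate regular variation gives limits only for sets whose frontier is
  \<open>\<mu>\<close>-null. No such condition is imposed on \<open>A\<close>, and in the
  compactified quadrant the frontier of the embedded set can moreover contain points with infinite
  coordinates. Working with all dilates of \<open>A\<close> at once answers both: at most countably
  many of them have a charged frontier, up to infinite points, and homogeneity fills the gaps; the
  same argument for the coordinates shows that infinite points carry no mass. No conditional
  distributions appear. The aggregate claim is a function of two outcomes, one for the claims and
  one for arrivals and returns; independence lets the diagonal be replaced by the product. Returns
  are observed at random arrival times, so the paths enter through joint measurability in time and
  outcome. The two tail classes have different tasks: class \<open>\<C>\<close> dominates whatever
  the value of \<open>\<mu>(A)\<close>, while regular variation passes from \<open>G\<close> to the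
  reduced claims along a nonzero limit of the tail ratio.\<close>

lemma class_RD:
  assumes "A \<in> class_R"
  shows "open A" "convex (- A)" "0 \<notin> closure A" "0 \<notin> A" "\<And>x y. x \<in> A \<Longrightarrow> y \<in> quadrant \<Longrightarrow> x + y \<in> A"
  using assms closure_subset[of A] by (auto simp: class_R_def increasing_set_def)

text \<open>The convex complement contains the origin, hence with any point the segment from it to
  the origin. A point whose multiple by \<open>s \<ge> 1\<close> left \<open>A\<close> would lie on
  such a segment.\<close>

lemma class_R_scale:
  assumes A: "A \<in> class_R" and a: "a \<in> A" and s: "1 \<le> s"
  shows "s *\<^sub>R a \<in> A"
proof (rule ccontr)
  assume n: "s *\<^sub>R a \<notin> A"
  have "(1 / s) *\<^sub>R (s *\<^sub>R a) + (1 - 1 / s) *\<^sub>R 0 \<in> - A"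
    using s n class_RD(4)[OF A] by (intro convexD[OF class_RD(2)[OF A]]) auto
  then show False using a s by auto
qed

text \<open>Points of the closure are moved into the set because the origin is interior to the convex complement.\<close>

lemma class_R_closure_scale:
  assumes A: "A \<in> class_R" and a: "a \<in> closure A" and s: "1 < s"
  shows "s *\<^sub>R a \<in> A"
proof (rule ccontr)
  assume n: "s *\<^sub>R a \<notin> A"
  have "0 \<in> interior (- A)"
    using class_RD(3)[OF A] by (simp add: interior_complement)
  then have "s *\<^sub>R a - (1 - 1 / s) *\<^sub>R (s *\<^sub>R a - 0) \<in> interior (- A)"
    using s n by (intro mem_interior_convex_shrink class_RD(2)[OF A]) auto
  moreover have "s *\<^sub>R a - (1 - 1 / s) *\<^sub>R (s *\<^sub>R a - 0) = a"
    using s by (simp add: algebra_simps)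
  ultimately show False using a by (simp add: interior_complement)
qed

lemma dilation_mem_iff:
  fixes A :: "(real ^ 'd) set"
  assumes "u \<noteq> 0"
  shows "z \<in> (\<lambda>a. u *\<^sub>R a) ` A \<longleftrightarrow> (1 / u) *\<^sub>R z \<in> A"
proof
  show "(1 / u) *\<^sub>R z \<in> A \<Longrightarrow> z \<in> (\<lambda>a. u *\<^sub>R a) ` A"
    using assms by (intro image_eqI[of _ _ "(1 / u) *\<^sub>R z"]) auto
qed (use assms in auto)

lemma class_R_norm_bound:
  assumes A: "A \<in> class_R"
  obtains e where "e > 0" "\<And>a. a \<in> A \<Longrightarrow> e \<le> norm a"
proof -
  have "open (- closure A)" "0 \<in> - closure A" using class_RD(3)[OF A] by auto
  then obtain e where e: "e > 0" "ball 0 e \<subseteq> - closure A"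
    by (meson open_contains_ball)
  have "e \<le> norm a" if "a \<in> A" for a
    using e(2) that closure_subset[of A] by (force simp: subset_eq not_less[symmetric])
  with e(1) show ?thesis using that by blast
qed

text \<open>\<open>Sup\<close> on the reals is informative only for bounded sets, so this fact
  precedes every use of \<open>reduct\<close>. Since \<open>z\<close> is arbitrary, \<open>u\<close>
  may be negative; hence the absolute value in the estimate.\<close>

lemma bdd_above_dilations:
  assumes A: "A \<in> class_R"
  shows "bdd_above {u. z \<in> (\<lambda>a. u *\<^sub>R a) ` A}"
proof -
  obtain e where e: "e > 0" "\<And>a. a \<in> A \<Longrightarrow> e \<le> norm a" using class_R_norm_bound[OF A] by blast
  have "u \<le> norm z / e" if "z = u *\<^sub>R a" "a \<in> A" for u a
  proof -
    have "u * e \<le> \<bar>u\<bar> * norm a" using e(1) e(2)[OF that(2)] by (intro mult_mono) auto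
    then show ?thesis using e(1) that(1) by (simp add: pos_le_divide_eq)
  qed
  then show ?thesis by (intro bdd_aboveI[of _ "norm z / e"]) auto
qed

text \<open>Most later facts about \<open>reduct\<close> go through this equivalence. Outward
  scaling brings a witness \<open>u > x\<close> down to \<open>x\<close>; conversely, as
  \<open>A\<close> is open, membership at \<open>x\<close> persists for some \<open>u > x\<close>,
  which makes the inequality strict.\<close>

lemma less_reduct_iff:
  assumes A: "A \<in> class_R" and x: "0 < x"
  shows "x < reduct A z \<longleftrightarrow> (1 / x) *\<^sub>R z \<in> A"
proof -
  define S where "S = {u. z \<in> (\<lambda>a. u *\<^sub>R a) ` A}"
  have bdd: "bdd_above S" unfolding S_def by (rule bdd_above_dilations[OF A])
  have red: "reduct A z = (if S = {} then 0 else Sup S)" by (simp add: reduct_def S_def)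
  show ?thesis
  proof
    assume "x < reduct A z"
    then have "S \<noteq> {}" "x < Sup S" using red x by (auto split: if_splits)
    then obtain u where u: "u \<in> S" "x < u" using less_cSup_iff[OF _ bdd] by blast
    then obtain a where a: "a \<in> A" "z = u *\<^sub>R a" by (auto simp: S_def)
    have "(u / x) *\<^sub>R a \<in> A" using u(2) x by (intro class_R_scale[OF A a(1)]) auto
    then show "(1 / x) *\<^sub>R z \<in> A" using a(2) by simp
  next
    assume m: "(1 / x) *\<^sub>R z \<in> A"
    have "isCont (\<lambda>u. (1 / u) *\<^sub>R z) x" using x by (intro continuous_intros) auto
    then have "\<forall>\<^sub>F u in at x. (1 / u) *\<^sub>R z \<in> A"
      using m class_RD(1)[OF A] by (auto simp: isCont_def elim!: topological_tendstoD)
    then have "\<forall>\<^sub>F u in at_right x. (1 / u) *\<^sub>R z \<in> A" "\<forall>\<^sub>F u in at_right x. x < u"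
      by (auto simp: eventually_at_split eventually_at_right_less)
    then have "\<exists>u. (1 / u) *\<^sub>R z \<in> A \<and> x < u"
      using eventually_conj eventually_happens' trivial_limit_at_right_real by blast
    then obtain u where u: "(1 / u) *\<^sub>R z \<in> A" "x < u" by blast
    then have "u \<in> S" using x by (auto simp: S_def dilation_mem_iff)
    then have "S \<noteq> {}" "u \<le> Sup S" using bdd by (auto intro: cSup_upper)
    then show "x < reduct A z" using red u(2) by auto
  qed
qed

lemma mem_dilation_iff_less_reduct:
  assumes A: "A \<in> class_R" and x: "0 < x"
  shows "z \<in> (\<lambda>a. x *\<^sub>R a) ` A \<longleftrightarrow> x < reduct A z"
  using less_reduct_iff[OF assms] dilation_mem_iff[of x z A] x by simp

text \<open>Because \<open>z\<close> need not lie in the quadrant, all admissible \<open>u\<close>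
  may be negative. With such a \<open>u\<close>, outward scaling makes every \<open>v\<close> in
  \<open>[u, 0)\<close> admissible as well, so the supremum is still at least
  \<open>0\<close>.\<close>

lemma reduct_nonneg:
  assumes A: "A \<in> class_R"
  shows "0 \<le> reduct A z"
proof -
  define S where "S = {u. z \<in> (\<lambda>a. u *\<^sub>R a) ` A}"
  have bdd: "bdd_above S" unfolding S_def by (rule bdd_above_dilations[OF A])
  have red: "reduct A z = (if S = {} then 0 else Sup S)" by (simp add: reduct_def S_def)
  have "0 \<le> Sup S" if "S \<noteq> {}"
  proof -
    obtain u where u: "u \<in> S" using \<open>S \<noteq> {}\<close> by blast
    have "v \<le> Sup S" if "v < 0" for v
    proof (cases "u \<le> v")
      case True
      obtain a where a: "a \<in> A" "z = u *\<^sub>R a" using u by (auto simp: S_def)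
      have "(u / v) *\<^sub>R a \<in> A" using True \<open>v < 0\<close> by (intro class_R_scale[OF A a(1)]) (auto simp: field_simps)
      then have "v \<in> S" using a(2) \<open>v < 0\<close> by (auto simp: S_def dilation_mem_iff)
      then show ?thesis using bdd by (rule cSup_upper)
    next
      case False
      then show ?thesis using cSup_upper[OF u bdd] by simp
    qed
    then show ?thesis by (rule dense_le)
  qed
  then show ?thesis using red by simp
qed

lemma reduct_measurable:
  assumes A: "A \<in> class_R"
  shows "reduct A \<in> borel_measurable borel"
proof (rule borel_measurableI_greater)
  have pos: "{z. y < reduct A z} \<in> sets borel" if "y > 0" for y
  proof -
    have "{z. y < reduct A z} = (\<lambda>z. (1 / y) *\<^sub>R z) -` A"
      using less_reduct_iff[OF A that] by auto
    moreover have "open \<dots>" using class_RD(1)[OF A] by (intro open_vimage continuous_intros)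
    ultimately show ?thesis by auto
  qed
  fix y :: real
  consider "y < 0" | "y = 0" | "y > 0" by linarith
  then show "{z \<in> space borel. y < reduct A z} \<in> sets borel"
  proof cases
    case 1
    then have "{z. y < reduct A z} = UNIV" using less_le_trans[OF _ reduct_nonneg[OF A]] by blast
    then show ?thesis by simp
  next
    case 2
    have "{z. 0 < reduct A z} = (\<Union>n. {z. 1 / Suc n < reduct A z})"
    proof (intro equalityI subsetI)
      fix z assume "z \<in> {z. 0 < reduct A z}"
      then obtain n where "1 / real (Suc n) < reduct A z" using nat_approx_posE by blast
      then show "z \<in> (\<Union>n. {z. 1 / Suc n < reduct A z})" by blast
    next
      fix z assume "z \<in> (\<Union>n. {z. 1 / Suc n < reduct A z})"
      then obtain n where "1 / real (Suc n) < reduct A z" by blast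
      then have "0 < reduct A z" by (rule less_trans[rotated]) simp
      then show "z \<in> {z. 0 < reduct A z}" by simp
    qed
    moreover have "\<dots> \<in> sets borel" using pos by (intro sets.countable_UN) auto
    ultimately show ?thesis using 2 by simp
  qed (use pos in auto)
qed

lemma reduct_zero:
  assumes A: "A \<in> class_R"
  shows "reduct A 0 = 0"
proof (rule ccontr)
  assume "reduct A 0 \<noteq> 0"
  then have "reduct A 0 / 2 < reduct A 0" "0 < reduct A 0 / 2" using reduct_nonneg[OF A, of 0] by auto
  then show False using less_reduct_iff[OF A, of "reduct A 0 / 2" 0] class_RD(4)[OF A] by simp
qed

text \<open>Lets inequalities between reducts be tested at positive levels alone, the levels to
  which \<open>less_reduct_iff\<close> applies; nonnegativity of \<open>b\<close> takes care of the
  rest.\<close>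

lemma le_if_less_imp_le:
  fixes a b :: real
  assumes "0 \<le> b" "\<And>x. 0 < x \<Longrightarrow> x < a \<Longrightarrow> x \<le> b"
  shows "a \<le> b"
proof (rule ccontr)
  assume "\<not> a \<le> b"
  then have "0 < (a + b) / 2" "(a + b) / 2 < a" "b < (a + b) / 2" using assms(1) by auto
  then show False using assms(2)[of "(a + b) / 2"] by linarith
qed

lemma reduct_scaleR:
  assumes A: "A \<in> class_R" and w: "0 < w"
  shows "reduct A (w *\<^sub>R z) = w * reduct A z"
proof -
  have *: "x < reduct A (w *\<^sub>R z) \<longleftrightarrow> x < w * reduct A z" if "0 < x" for x
  proof -
    have "x < reduct A (w *\<^sub>R z) \<longleftrightarrow> (1 / (x / w)) *\<^sub>R z \<in> A"
      using less_reduct_iff[OF A that, of "w *\<^sub>R z"] by simp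
    also have "\<dots> \<longleftrightarrow> x / w < reduct A z" using that w by (intro less_reduct_iff[OF A, symmetric]) auto
    finally show ?thesis using w by (simp add: pos_divide_less_eq mult.commute)
  qed
  have nn: "0 \<le> w * reduct A z" using w reduct_nonneg[OF A, of z] by simp
  show ?thesis
  proof (rule antisym)
    show "reduct A (w *\<^sub>R z) \<le> w * reduct A z"
      by (rule le_if_less_imp_le) (simp_all add: * nn less_imp_le)
    show "w * reduct A z \<le> reduct A (w *\<^sub>R z)"
      by (rule le_if_less_imp_le) (simp_all add: *[symmetric] reduct_nonneg[OF A] less_imp_le)
  qed
qed

text \<open>\<open>reduct A\<close> is the gauge of the convex complement, and this is the
  subadditivity of gauges: for \<open>u\<close>, \<open>v\<close> slightly above the two values,
  \<open>y / u\<close> and \<open>z / v\<close> lie outside \<open>A\<close>, and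
  \<open>(y + z) / (u + v)\<close> is their average with weights \<open>u / (u + v)\<close> and
  \<open>v / (u + v)\<close>.\<close>

lemma reduct_add_le:
  assumes A: "A \<in> class_R"
  shows "reduct A (y + z) \<le> reduct A y + reduct A z"
proof (rule ccontr)
  assume n: "\<not> reduct A (y + z) \<le> reduct A y + reduct A z"
  \<comment> \<open>One third of the gap: \<open>u + v\<close> exceeds the sum of the reducts by
    \<open>2 * d\<close> and stays strictly below \<open>reduct A (y + z)\<close>. Also,
    \<open>d > 0\<close> makes \<open>u\<close> and \<open>v\<close> positive.\<close>
  define d where "d = (reduct A (y + z) - (reduct A y + reduct A z)) / 3"
  define u v where "u = reduct A y + d" and "v = reduct A z + d"
  have d: "d > 0" using n by (simp add: d_def)
  then have uv: "0 < u" "0 < v" using reduct_nonneg[OF A] by (auto simp: u_def v_def add_nonneg_pos)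
  have lt: "u + v < reduct A (y + z)" using n by (simp add: u_def v_def d_def field_simps)
  have "(1 / u) *\<^sub>R y \<in> - A" "(1 / v) *\<^sub>R z \<in> - A"
    using less_reduct_iff[OF A uv(1), of y] less_reduct_iff[OF A uv(2), of z] d
    by (auto simp: u_def v_def)
  then have "(u / (u + v)) *\<^sub>R ((1 / u) *\<^sub>R y) + (v / (u + v)) *\<^sub>R ((1 / v) *\<^sub>R z) \<in> - A"
    using uv by (intro convexD[OF class_RD(2)[OF A]]) (auto simp: add_divide_distrib[symmetric])
  moreover have "(u / (u + v)) *\<^sub>R ((1 / u) *\<^sub>R y) + (v / (u + v)) *\<^sub>R ((1 / v) *\<^sub>R z) = (1 / (u + v)) *\<^sub>R (y + z)"
    using uv by (simp add: scaleR_add_right)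
  ultimately show False using less_reduct_iff[OF A _ , of "u + v" "y + z"] uv lt by auto
qed

lemma reduct_sum_le:
  assumes A: "A \<in> class_R"
  shows "reduct A (\<Sum>i\<in>I. f i) \<le> (\<Sum>i\<in>I. reduct A (f i))"
proof (induction I rule: infinite_finite_induct)
  case (insert i I)
  then show ?case using reduct_add_le[OF A, of "f i" "sum f I"] by simp
qed (auto simp: reduct_zero[OF A])

lemma reduct_mono:
  assumes A: "A \<in> class_R" and y: "y \<in> quadrant"
  shows "reduct A z \<le> reduct A (z + y)"
proof (rule le_if_less_imp_le)
  fix x :: real assume x: "0 < x" "x < reduct A z"
  then have "(1 / x) *\<^sub>R z + (1 / x) *\<^sub>R y \<in> A"
    using less_reduct_iff[OF A x(1), of z] y
    by (intro class_RD(5)[OF A]) (auto simp: quadrant_def)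
  then show "x \<le> reduct A (z + y)"
    using less_reduct_iff[OF A x(1), of "z + y"] by (simp add: scaleR_add_right)
qed (rule reduct_nonneg[OF A])

lemma quadrant_sum: "(\<And>i. i \<in> I \<Longrightarrow> f i \<in> quadrant) \<Longrightarrow> (\<Sum>i\<in>I. f i) \<in> quadrant"
  by (auto simp: quadrant_def intro: sum_nonneg)

lemma quadrant_scaleR: "0 \<le> w \<Longrightarrow> z \<in> quadrant \<Longrightarrow> w *\<^sub>R z \<in> quadrant"
  by (auto simp: quadrant_def)

lemma reduct_le_sum:
  assumes A: "A \<in> class_R" and I: "finite I" "i \<in> I" and f: "\<And>j. j \<in> I \<Longrightarrow> f j \<in> quadrant"
  shows "reduct A (f i) \<le> reduct A (\<Sum>j\<in>I. f j)"
proof -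
  have "reduct A (f i) \<le> reduct A (f i + (\<Sum>j\<in>I - {i}. f j))"
    using f by (intro reduct_mono[OF A] quadrant_sum) auto
  then show ?thesis using I by (simp add: sum.remove)
qed

section \<open>Potter bounds and weighted sums of claims\<close>

text \<open>Doubling is iterated \<open>k\<close> times with \<open>b ^ k\<close> near
  \<open>1 / y\<close>; since \<open>k\<close> is logarithmic in \<open>y\<close>, the factor
  \<open>2 ^ k\<close> is polynomial in \<open>y\<close>.\<close>

lemma potter_bound:
  fixes p :: "real \<Rightarrow> real"
  assumes anti: "\<And>x y. x \<le> y \<Longrightarrow> p y \<le> p x" and pos: "\<And>x. 0 < p x" and le1: "\<And>x. p x \<le> 1"
    and b: "0 < b" "b < 1" and x0: "0 < x0" and dbl: "\<And>x. x0 \<le> x \<Longrightarrow> p (b * x) \<le> 2 * p x"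
  shows "\<exists>C>0. \<exists>q. \<forall>x\<ge>x0. \<forall>y\<ge>1. p (x / y) \<le> C * y ^ q * p x"
proof -
  have iter: "p (b ^ k * x) * p x0 \<le> 2 ^ k * p x" if "x0 \<le> x" for k x
    using that
  proof (induction k arbitrary: x)
    case 0
    then show ?case using le1[of x0] pos[of x] by (simp add: mult_left_le)
  next
    case (Suc k)
    show ?case
    proof (cases "x0 \<le> b * x")
      case True
      have "p (b ^ Suc k * x) * p x0 = p (b ^ k * (b * x)) * p x0" by (simp add: algebra_simps)
      also have "\<dots> \<le> 2 ^ k * p (b * x)" by (rule Suc.IH[OF True])
      also have "\<dots> \<le> 2 ^ k * (2 * p x)" using dbl[OF Suc.prems] by (intro mult_left_mono) auto
      finally show ?thesis by simp
    next
      case False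
      have "p (b ^ Suc k * x) * p x0 \<le> 1 * p x0"
        using le1 pos[of x0] by (intro mult_right_mono) auto
      also have "\<dots> \<le> p (b * x)" using False anti by simp
      also have "\<dots> \<le> 2 * p x" using dbl[OF Suc.prems] .
      also have "\<dots> \<le> 2 ^ Suc k * p x" using pos[of x] by (intro mult_right_mono) auto
      finally show ?thesis .
    qed
  qed
  \<comment> \<open>A natural exponent that converts powers of \<open>2\<close> into powers of
    \<open>y\<close>: from \<open>(1 / b) ^ m \<le> y\<close> follows
    \<open>2 ^ m \<le> y ^ q\<close>.\<close>
  obtain q where q: "2 \<le> (1 / b) ^ q"
    using real_arch_pow[of "1 / b" 2] b by (auto intro: less_imp_le)
  have bound: "p (x / y) \<le> (2 / p x0) * y ^ q * p x" if x: "x0 \<le> x" and y: "1 \<le> y" for x y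
  proof -
    \<comment> \<open>Minimality gives \<open>(1 / b) ^ (k - 1) \<le> y\<close> for positive
      \<open>k\<close>; the last step costs one further factor \<open>2\<close>, whence the
      \<open>2\<close> in the constant.\<close>
    define k where "k = (LEAST k. b ^ k \<le> 1 / y)"
    have "\<exists>k. b ^ k \<le> 1 / y"
      using real_arch_pow_inv[of "1 / y" b] b y by (auto intro: less_imp_le)
    then have k: "b ^ k \<le> 1 / y" unfolding k_def by (rule LeastI_ex)
    have pw: "2 ^ k \<le> 2 * y ^ q"
    proof (cases k)
      case 0
      then show ?thesis using one_le_power[OF y, of q] by simp
    next
      case (Suc m)
      then have "\<not> b ^ m \<le> 1 / y" using not_less_Least[of m "\<lambda>k. b ^ k \<le> 1 / y"] by (simp add: k_def)
      then have m: "(1 / b) ^ m \<le> y" using b y by (simp add: power_one_over field_simps)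
      have "2 ^ m \<le> ((1 / b) ^ q) ^ m" using q by (intro power_mono) auto
      also have "\<dots> = ((1 / b) ^ m) ^ q" by (simp add: power_mult[symmetric] mult.commute)
      also have "\<dots> \<le> y ^ q" using m b by (intro power_mono) auto
      finally show ?thesis using Suc by simp
    qed
    have "p (x / y) * p x0 \<le> p (b ^ k * x) * p x0"
      using k x x0 mult_right_mono[OF k, of x] pos[of x0] by (intro mult_right_mono anti) auto
    also have "\<dots> \<le> 2 ^ k * p x" by (rule iter[OF x])
    also have "\<dots> \<le> 2 * y ^ q * p x" using pw pos[of x] by (intro mult_right_mono) auto
    finally show ?thesis using pos[of x0] by (simp add: field_simps)
  qed
  show ?thesis
    using bound pos[of x0] by (intro exI[of _ "2 / p x0"] conjI exI[of _ q]) auto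
qed

text \<open>Induction with inclusion-exclusion for two sets. Each pair is subtracted in both orders,
  which is cruder than the classical bound but harmless: under quasi-asymptotic independence the
  pair terms are negligible.\<close>

lemma (in prob_space) bonferroni_lower:
  assumes "finite I" "\<And>i. i \<in> I \<Longrightarrow> E i \<in> events"
  shows "(\<Sum>i\<in>I. prob (E i)) - (\<Sum>i\<in>I. \<Sum>j\<in>I - {i}. prob (E i \<inter> E j)) \<le> prob (\<Union>i\<in>I. E i)"
  using assms
proof (induction I rule: finite_induct)
  case (insert a I)
  have ev: "E a \<in> events" "(\<Union>i\<in>I. E i) \<in> events" using insert by auto
  have "prob (E a \<inter> (\<Union>i\<in>I. E i)) = prob (\<Union>i\<in>I. E a \<inter> E i)" by (simp only: Int_UN_distrib)
  also have "\<dots> \<le> (\<Sum>i\<in>I. prob (E a \<inter> E i))"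
    using insert by (intro finite_measure_subadditive_finite) auto
  finally have 1: "prob (E a \<inter> (\<Union>i\<in>I. E i)) \<le> (\<Sum>i\<in>I. prob (E a \<inter> E i))" .
  have "(\<Sum>i\<in>I. \<Sum>j\<in>I - {i}. prob (E i \<inter> E j)) \<le> (\<Sum>i\<in>I. \<Sum>j\<in>insert a I - {i}. prob (E i \<inter> E j))"
    using insert by (intro sum_mono sum_mono2) auto
  moreover have "insert a I - {a} = I" using insert by auto
  moreover have "prob (\<Union>i\<in>insert a I. E i) = prob (E a) + prob (\<Union>i\<in>I. E i) - prob (E a \<inter> (\<Union>i\<in>I. E i))"
    using finite_measure_Union'[OF ev] finite_measure_Diff'[OF ev(2,1)] by (simp add: Int_commute)
  ultimately show ?case using insert 1 by auto
qed simp

text \<open>The single big jump: let \<open>a k\<close> be the largest term. Unless two terms are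
  both large, all others are at most \<open>d * x / (card I + 1)\<close>, together at most
  \<open>d * x\<close>, so \<open>a k\<close> alone must exceed \<open>(1 - d) * x\<close>.\<close>

lemma sum_gt_cases:
  fixes a :: "'i \<Rightarrow> real"
  assumes I: "finite I" and x: "0 < x" "x < (\<Sum>i\<in>I. a i)" and d: "0 < d"
  shows "(\<exists>i\<in>I. (1 - d) * x < a i) \<or>
     (\<exists>i\<in>I. \<exists>j\<in>I - {i}. d * x / (card I + 1) < a i \<and> d * x / (card I + 1) < a j)"
proof (rule ccontr)
  assume n: "\<not> ?thesis"
  define e where "e = d * x / (card I + 1)"
  have e: "0 < e" using x d by (simp add: e_def)
  have "I \<noteq> {}" using x by auto
  then have "Max (a ` I) \<in> a ` I" using I by (intro Max_in) auto
  then obtain k where k: "k \<in> I" "a k = Max (a ` I)" by auto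
  have "a i \<le> a k" if "i \<in> I" for i using that I k(2) by simp
  moreover have "\<not> (e < a k \<and> e < a j)" if "j \<in> I - {k}" for j
    using n k(1) that unfolding e_def by blast
  ultimately have small: "a j \<le> e" if "j \<in> I - {k}" for j
    using that by (meson DiffD1 not_less less_le_trans)
  have "(\<Sum>i\<in>I - {k}. a i) \<le> (\<Sum>i\<in>I - {k}. e)" by (intro sum_mono small)
  also have "\<dots> \<le> card I * e"
    using e I by (auto intro!: mult_right_mono card_mono)
  also have "\<dots> \<le> d * x" using d x by (simp add: e_def field_simps)
  finally have "(\<Sum>i\<in>I. a i) \<le> (1 - d) * x + d * x"
    using n k(1) I by (subst sum.remove[of _ k]) (auto simp: not_less intro!: add_mono)
  then show False using x by (simp add: algebra_simps)
qed

text \<open>\<open>Y\<close> is only known to lie between the largest weighted term and the weighted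
  sum. Both bounds have the same tail asymptotics: the lower estimate is Bonferroni's inequality for
  the maximum, the upper one the single big jump for the sum.\<close>

lemma (in prob_space) weighted_max_sum_tail:
  fixes Z :: "'i \<Rightarrow> 'a \<Rightarrow> real" and p :: "real \<Rightarrow> real"
  assumes I: "finite I"
    and Z [measurable]: "\<And>i. i \<in> I \<Longrightarrow> Z i \<in> borel_measurable M"
    and Zp: "\<And>i x. i \<in> I \<Longrightarrow> prob {\<omega> \<in> space M. x < Z i \<omega>} = p x"
    and pos: "\<And>x. 0 < p x"
    and rv: "\<And>y. 0 < y \<Longrightarrow> ((\<lambda>x. p (y * x) / p x) \<longlongrightarrow> y powr (-\<alpha>)) at_top"
    and qai: "\<And>i j. i \<in> I \<Longrightarrow> j \<in> I \<Longrightarrow> i \<noteq> j \<Longrightarrow>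
      ((\<lambda>x. prob {\<omega> \<in> space M. x < Z i \<omega> \<and> x < Z j \<omega>} / p x) \<longlongrightarrow> 0) at_top"
    and w: "\<And>i. i \<in> I \<Longrightarrow> 0 < w i"
    and Y [measurable]: "Y \<in> borel_measurable M"
    and le_sum: "AE \<omega> in M. Y \<omega> \<le> (\<Sum>i\<in>I. w i * Z i \<omega>)"
    and ge_max: "AE \<omega> in M. \<forall>i\<in>I. w i * Z i \<omega> \<le> Y \<omega>"
  shows "((\<lambda>x. prob {\<omega> \<in> space M. x < Y \<omega>} / p x) \<longlongrightarrow> (\<Sum>i\<in>I. w i powr \<alpha>)) at_top"
proof -
  define S where "S = (\<Sum>i\<in>I. w i powr \<alpha>)"
  define P2 where "P2 i j x = prob {\<omega> \<in> space M. x < Z i \<omega> \<and> x < Z j \<omega>}" for i j x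
  \<comment> \<open>Quasi-asymptotic independence is applied at the level \<open>v * x\<close>;
    regular variation then replaces the normalisation \<open>p (v * x)\<close> by
    \<open>p x\<close>.\<close>
  have pair: "((\<lambda>x. P2 i j (v * x) / p x) \<longlongrightarrow> 0) at_top"
    if ij: "i \<in> I" "j \<in> I" "i \<noteq> j" and v: "0 < v" for i j v
  proof -
    have "((\<lambda>x. P2 i j (v * x) / p (v * x) * (p (v * x) / p x)) \<longlongrightarrow> 0 * v powr (-\<alpha>)) at_top"
      using v unfolding P2_def
      by (intro tendsto_mult rv filterlim_compose[OF qai[OF ij]]
          filterlim_tendsto_pos_mult_at_top[OF tendsto_const] filterlim_ident) auto
    moreover have "P2 i j (v * x) / p (v * x) * (p (v * x) / p x) = P2 i j (v * x) / p x" for x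
      using pos[of "v * x"] by simp
    ultimately show ?thesis by (simp only: mult_zero_left)
  qed
  have single: "((\<lambda>x. \<Sum>i\<in>I. p (c / w i * x) / p x) \<longlongrightarrow> c powr (-\<alpha>) * S) at_top" if c: "0 < c" for c
  proof -
    have "((\<lambda>x. \<Sum>i\<in>I. p (c / w i * x) / p x) \<longlongrightarrow> (\<Sum>i\<in>I. (c / w i) powr (-\<alpha>))) at_top"
      using w c by (intro tendsto_sum rv) auto
    also have "(\<Sum>i\<in>I. (c / w i) powr (-\<alpha>)) = c powr (-\<alpha>) * S"
      using w c unfolding S_def sum_distrib_left
      by (intro sum.cong refl) (auto simp: powr_divide powr_minus field_simps)
    finally show ?thesis .
  qed
  \<comment> \<open>The two thresholds \<open>c / w i\<close> and \<open>c / w j\<close> differ,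
    while the hypothesis on pairs has one common level; the smaller threshold enlarges the event and
    serves for both.\<close>
  have pairs: "((\<lambda>x. \<Sum>i\<in>I. \<Sum>j\<in>I - {i}. P2 i j (min (c / w i) (c / w j) * x) / p x) \<longlongrightarrow> 0) at_top"
    if c: "0 < c" for c
    using w c by (intro tendsto_null_sum pair) auto
  show ?thesis unfolding S_def[symmetric]
  proof (rule order_tendstoI)
    fix a assume a: "a < S"
    define L where "L x = (\<Sum>i\<in>I. p (1 / w i * x) / p x)
        - (\<Sum>i\<in>I. \<Sum>j\<in>I - {i}. P2 i j (min (1 / w i) (1 / w j) * x) / p x)" for x
    have "(L \<longlongrightarrow> 1 powr (-\<alpha>) * S - 0) at_top"
      unfolding L_def by (intro tendsto_diff single pairs) auto
    then have "\<forall>\<^sub>F x in at_top. a < L x" using a by (intro order_tendstoD(1)) auto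
    moreover have "\<forall>\<^sub>F x in at_top. L x \<le> prob {\<omega> \<in> space M. x < Y \<omega>} / p x"
      using eventually_gt_at_top[of 0]
    proof eventually_elim
      case (elim x)
      define E where "E i = {\<omega> \<in> space M. 1 / w i * x < Z i \<omega>}" for i
      have E: "E i \<in> events" if "i \<in> I" for i unfolding E_def using that by measurable
      have "prob (E i \<inter> E j) \<le> P2 i j (min (1 / w i) (1 / w j) * x)" if "i \<in> I" "j \<in> I - {i}" for i j
        unfolding P2_def using that elim
        by (intro finite_measure_mono) (auto simp: E_def min_mult_distrib_right min_less_iff_disj)
      then have "L x * p x \<le> (\<Sum>i\<in>I. prob (E i)) - (\<Sum>i\<in>I. \<Sum>j\<in>I - {i}. prob (E i \<inter> E j))"
        using pos[of x] Zp
        by (auto simp: L_def E_def left_diff_distrib sum_distrib_right intro!: diff_mono sum_mono)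
      also have "\<dots> \<le> prob (\<Union>i\<in>I. E i)" by (rule bonferroni_lower[OF I E])
      also have "\<dots> \<le> prob {\<omega> \<in> space M. x < Y \<omega>}"
      proof (rule finite_measure_mono_AE)
        show "AE \<omega> in M. \<omega> \<in> (\<Union>i\<in>I. E i) \<longrightarrow> \<omega> \<in> {\<omega> \<in> space M. x < Y \<omega>}"
          using ge_max
        proof eventually_elim
          case (elim \<omega>)
          then show ?case using w by (force simp: E_def field_simps)
        qed
      qed measurable
      finally show ?case using pos[of x] by (simp add: field_simps)
    qed
    ultimately show "\<forall>\<^sub>F x in at_top. a < prob {\<omega> \<in> space M. x < Y \<omega>} / p x"
      by eventually_elim simp
  next
    fix a assume a: "S < a"
    \<comment> \<open>Since \<open>S < a\<close>, continuity at \<open>d = 0\<close> leaves room for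
      the loss \<open>(1 - d) powr (-\<alpha>)\<close> caused by lowering the threshold of the big
      jump.\<close>
    have "((\<lambda>d. (1 - d) powr (-\<alpha>) * S) \<longlongrightarrow> (1 - 0) powr (-\<alpha>) * S) (at_right 0)"
      by (intro tendsto_intros) auto
    then have "\<forall>\<^sub>F d in at_right 0. (1 - d) powr (-\<alpha>) * S < a \<and> 0 < d \<and> d < 1"
      using a by (intro eventually_conj eventually_at_right_less eventually_at_rightI[of 0 1] order_tendstoD(2)) auto
    then obtain d where d: "(1 - d) powr (-\<alpha>) * S < a" "0 < d" "d < 1"
      using eventually_happens' trivial_limit_at_right_real by blast
    define c where "c = d / (card I + 1)"
    have c: "0 < c" using d by (simp add: c_def)
    define U where "U x = (\<Sum>i\<in>I. p ((1 - d) / w i * x) / p x)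
        + (\<Sum>i\<in>I. \<Sum>j\<in>I - {i}. P2 i j (min (c / w i) (c / w j) * x) / p x)" for x
    have "(U \<longlongrightarrow> (1 - d) powr (-\<alpha>) * S + 0) at_top"
      unfolding U_def using d c by (intro tendsto_add single pairs) auto
    then have "\<forall>\<^sub>F x in at_top. U x < a" using d by (intro order_tendstoD(2)) auto
    moreover have "\<forall>\<^sub>F x in at_top. prob {\<omega> \<in> space M. x < Y \<omega>} / p x \<le> U x"
      using eventually_gt_at_top[of 0]
    proof eventually_elim
      case (elim x)
      define E where "E i = {\<omega> \<in> space M. (1 - d) / w i * x < Z i \<omega>}" for i
      define D where "D i j = {\<omega> \<in> space M. min (c / w i) (c / w j) * x < Z i \<omega> \<and> min (c / w i) (c / w j) * x < Z j \<omega>}" for i j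
      have E: "E i \<in> events" if "i \<in> I" for i unfolding E_def using that by measurable
      have D: "D i j \<in> events" if "i \<in> I" "j \<in> I - {i}" for i j
      proof -
        have [measurable]: "Z i \<in> borel_measurable M" "Z j \<in> borel_measurable M" using that by auto
        show ?thesis unfolding D_def by measurable
      qed
      have "prob {\<omega> \<in> space M. x < Y \<omega>} \<le> prob ((\<Union>i\<in>I. E i) \<union> (\<Union>i\<in>I. \<Union>j\<in>I - {i}. D i j))"
      proof (rule finite_measure_mono_AE)
        show "AE \<omega> in M. \<omega> \<in> {\<omega> \<in> space M. x < Y \<omega>} \<longrightarrow> \<omega> \<in> (\<Union>i\<in>I. E i) \<union> (\<Union>i\<in>I. \<Union>j\<in>I - {i}. D i j)"
          using le_sum
        proof eventually_elim
          case (elim \<omega>)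
          show ?case
          proof
            assume om: "\<omega> \<in> {\<omega> \<in> space M. x < Y \<omega>}"
            then have "x < (\<Sum>i\<in>I. w i * Z i \<omega>)" using elim by auto
            from sum_gt_cases[OF I \<open>0 < x\<close> this d(2)]
            show "\<omega> \<in> (\<Union>i\<in>I. E i) \<union> (\<Union>i\<in>I. \<Union>j\<in>I - {i}. D i j)"
            proof (elim disjE bexE conjE)
              fix i assume i: "i \<in> I" "(1 - d) * x < w i * Z i \<omega>"
              then have "\<omega> \<in> E i" using om w[OF i(1)] by (auto simp: E_def field_simps)
              then show ?thesis using i by auto
            next
              fix i j assume ij: "i \<in> I" "j \<in> I - {i}" "d * x / (card I + 1) < w i * Z i \<omega>"
                "d * x / (card I + 1) < w j * Z j \<omega>"
              have "c / w i * x < Z i \<omega>" "c / w j * x < Z j \<omega>"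
                using ij w[of i] w[of j] by (auto simp: c_def pos_divide_less_eq mult_ac)
              then have "\<omega> \<in> D i j" using om \<open>0 < x\<close>
                by (auto simp: D_def min_mult_distrib_right min_less_iff_disj)
              then show ?thesis using ij by auto
            qed
          qed
        qed
        show "(\<Union>i\<in>I. E i) \<union> (\<Union>i\<in>I. \<Union>j\<in>I - {i}. D i j) \<in> events"
          using I E D by (intro sets.Un sets.finite_UN) auto
      qed
      also have "\<dots> \<le> prob (\<Union>i\<in>I. E i) + prob (\<Union>i\<in>I. \<Union>j\<in>I - {i}. D i j)"
        using I E D by (intro measure_Un_le sets.finite_UN) auto
      also have "\<dots> \<le> (\<Sum>i\<in>I. prob (E i)) + (\<Sum>i\<in>I. \<Sum>j\<in>I - {i}. prob (D i j))"
        using I E D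
        by (intro add_mono finite_measure_subadditive_finite order_trans[OF finite_measure_subadditive_finite] sum_mono
            sets.finite_UN) auto
      also have "\<dots> = U x * p x"
        using Zp pos[of x] by (auto simp: U_def E_def D_def P2_def distrib_right sum_distrib_right intro!: sum.cong)
      finally show ?case using pos[of x] by (simp add: field_simps)
    qed
    ultimately show "\<forall>\<^sub>F x in at_top. prob {\<omega> \<in> space M. x < Y \<omega>} / p x < a"
      by eventually_elim simp
  qed
qed

section \<open>Tails of the reduced claims\<close>

lemma regularly_varying_ratio:
  assumes "regularly_varying \<alpha> G" "0 < y"
  shows "((\<lambda>x. tail G (y * x) / tail G x) \<longlongrightarrow> y powr (-\<alpha>)) at_top"
proof -
  have pos: "\<forall>\<^sub>F x in at_top. tail G x \<noteq> 0"
    using eventually_ge_at_top[of 0]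
  proof eventually_elim
    case (elim x)
    then have "0 < tail G x" using assms(1) by (simp add: regularly_varying_def halfline_distribution_def)
    then show ?case by simp
  qed
  have "(\<lambda>x. tail G (y * x)) \<sim>[at_top] (\<lambda>x. y powr (-\<alpha>) * tail G x)"
    using assms by (simp add: regularly_varying_def)
  then have "((\<lambda>x. tail G (y * x) / (y powr (-\<alpha>) * tail G x)) \<longlongrightarrow> 1) at_top"
    by (rule asymp_equivD_strong) (use pos assms(2) in \<open>auto elim!: eventually_mono\<close>)
  then have "((\<lambda>x. y powr (-\<alpha>) * (tail G (y * x) / (y powr (-\<alpha>) * tail G x))) \<longlongrightarrow> y powr (-\<alpha>) * 1) at_top"
    by (intro tendsto_mult tendsto_const)
  then show ?thesis using assms(2) by simp
qed

text \<open>Tychonoff's theorem, carried over from functions by the continuous map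
  \<open>vec_lambda\<close>. In consequence every closed set that misses the origin is compact, so
  that a Radon measure is finite on it.\<close>

lemma compact_UNIV_ennreal_vec: "compact (UNIV :: (ennreal ^ 'd) set)"
proof -
  have "compact_space (euclidean :: ennreal topology)" by (simp add: compact_space_def compact_UNIV)
  then have "compact_space (product_topology (\<lambda>_::'d. euclidean :: ennreal topology) UNIV)"
    by (simp add: compact_space_product_topology)
  then have "compact (UNIV :: ('d \<Rightarrow> ennreal) set)"
    by (simp add: euclidean_product_topology compact_space_def)
  moreover have "continuous_on UNIV (vec_lambda :: ('d \<Rightarrow> ennreal) \<Rightarrow> ennreal ^ 'd)"
    using continuous_on_vec_lambda[of UNIV "\<lambda>i f. f i"] by (simp add: continuous_on_product_coordinates)
  ultimately have "compact (range (vec_lambda :: ('d \<Rightarrow> ennreal) \<Rightarrow> ennreal ^ 'd))"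
    by (rule compact_continuous_image[rotated])
  moreover have "range (vec_lambda :: ('d \<Rightarrow> ennreal) \<Rightarrow> ennreal ^ 'd) = UNIV"
    using vec_lambda_eta by (metis surjI)
  ultimately show ?thesis by simp
qed

lemma radon_punctured_sets:
  fixes \<mu> :: "(ennreal ^ 'd) measure"
  assumes "radon_punctured \<mu>"
  shows "B \<in> sets \<mu> \<longleftrightarrow> B \<in> sets borel \<and> 0 \<notin> B"
proof -
  have "{0} = {b :: ennreal ^ 'd. \<forall>j. b $ j \<le> 0}" by (auto simp: vec_eq_iff)
  moreover have "closed \<dots>" by (intro closed_Collect_all closed_Collect_le continuous_intros)
  ultimately have "- {0} \<in> sets (borel :: (ennreal ^ 'd) measure)" by auto
  then show ?thesis
    using assms by (auto simp: radon_punctured_def sets_restrict_space_iff)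
qed

lemma radon_punctured_finite:
  fixes \<mu> :: "(ennreal ^ 'd) measure"
  assumes \<mu>: "radon_punctured \<mu>" and B: "0 \<notin> closure B"
  shows "emeasure \<mu> B < \<infinity>"
proof -
  have c: "compact (closure B)"
    using compact_Int_closed[OF compact_UNIV_ennreal_vec, of "closure B"] by simp
  have "emeasure \<mu> B \<le> emeasure \<mu> (closure B)"
    using B by (intro emeasure_mono closure_subset) (auto simp: radon_punctured_sets[OF \<mu>])
  also have "\<dots> < \<infinity>" using \<mu> c B by (auto simp: radon_punctured_def)
  finally show ?thesis .
qed

lemma embed_measurable [measurable]: "embed \<in> borel_measurable borel"
  unfolding embed_def
  by (intro borel_measurable_continuous_onI continuous_on_vec_lambda continuous_on_ennreal continuous_intros)

lemma embed_mem_dilate_iff: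
  assumes x: "0 < x" and z: "z \<in> quadrant"
  shows "embed z \<in> dilate x B \<longleftrightarrow> embed ((1 / x) *\<^sub>R z) \<in> B"
proof
  have nn: "0 \<le> z $ j" for j using z by (simp add: quadrant_def)
  assume "embed z \<in> dilate x B"
  then obtain b where b: "b \<in> B" "embed z = (\<chi> j. ennreal x * b $ j)" by (auto simp: dilate_def)
  have "b $ j = ennreal (z $ j / x)" for j
  proof -
    have "ennreal x * b $ j = ennreal (z $ j)"
      using arg_cong[OF b(2), of "\<lambda>v. v $ j"] by (simp add: embed_def)
    also have "\<dots> = ennreal x * ennreal (z $ j / x)" using x nn[of j] by (simp add: ennreal_mult[symmetric])
    finally show ?thesis using x by (simp add: ennreal_mult_cancel_left)
  qed
  then have "b = embed ((1 / x) *\<^sub>R z)" by (simp add: embed_def vec_eq_iff)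
  with b(1) show "embed ((1 / x) *\<^sub>R z) \<in> B" by simp
next
  have nn: "0 \<le> z $ j" for j using z by (simp add: quadrant_def)
  assume b: "embed ((1 / x) *\<^sub>R z) \<in> B"
  have "embed z = (\<chi> j. ennreal x * embed ((1 / x) *\<^sub>R z) $ j)"
    using x nn by (simp add: embed_def vec_eq_iff ennreal_mult[symmetric])
  then show "embed z \<in> dilate x B" using b by (auto simp: dilate_def)
qed

text \<open>The frontier of a level set need not be null a priori. Almost every level is a continuity
  level, and regular variation transfers the limit from one such level to all others.\<close>

lemma MRV_level_sets:
  fixes g :: "ennreal ^ 'd \<Rightarrow> ennreal" and f :: "real ^ 'd \<Rightarrow> real"
  assumes V: "V \<in> MRV \<alpha> \<mu> G" "sets V = sets borel" "prob_space V"
    and alpha: "0 < \<alpha>"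
    and op: "\<And>t. 0 < t \<Longrightarrow> open {b. ennreal t < g b}"
    and zero: "\<And>t. 0 < t \<Longrightarrow> 0 \<notin> closure {b. ennreal t < g b}"
    and front: "\<And>t. 0 < t \<Longrightarrow> frontier {b. ennreal t < g b} \<subseteq> {b. g b = ennreal t} \<union> N"
    and N: "N \<in> null_sets \<mu>"
    and f [measurable]: "f \<in> borel_measurable borel"
    and gf: "\<And>z x t. z \<in> quadrant \<Longrightarrow> 0 < x \<Longrightarrow> 0 < t \<Longrightarrow>
      ennreal t < g (embed ((1 / x) *\<^sub>R z)) \<longleftrightarrow> t * x < f z"
  shows "\<exists>c. (\<forall>t>0. measure \<mu> {b. ennreal t < g b} = c * t powr (-\<alpha>)) \<and>
    ((\<lambda>x. measure V {z. x < f z} / tail G x) \<longlongrightarrow> c) at_top"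
proof -
  interpret V: prob_space V by fact
  have rv: "regularly_varying \<alpha> G" and \<mu>: "radon_punctured \<mu>" and quad: "AE z in V. z \<in> quadrant"
    and lim: "\<And>B. B \<in> sets borel \<Longrightarrow> 0 \<notin> closure B \<Longrightarrow> emeasure \<mu> (frontier B) = 0 \<Longrightarrow>
        ((\<lambda>x. measure V {z. embed z \<in> dilate x B} / tail G x) \<longlongrightarrow> measure \<mu> B) at_top"
    using V(1) by (auto simp: MRV_def)
  define S where "S t = {b. ennreal t < g b}" for t
  define \<phi> where "\<phi> t = measure \<mu> (S t)" for t
  define R where "R x = measure V {z. x < f z} / tail G x" for x
  have S_sets: "S t \<in> sets \<mu>" "S t \<in> sets borel" if "0 < t" for t
    using op[OF that] zero[OF that] closure_subset[of "S t"]
    by (auto simp: S_def radon_punctured_sets[OF \<mu>])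
  have S_fin: "emeasure \<mu> (S t) < \<infinity>" if "0 < t" for t
    using radon_punctured_finite[OF \<mu> zero[OF that]] by (simp add: S_def)
  have S_mono: "S t \<subseteq> S s" if "s \<le> t" for s t
    using that by (auto simp: S_def intro: le_less_trans[OF ennreal_leI])
  have \<phi>_mono: "\<phi> t \<le> \<phi> s" if "0 < s" "s \<le> t" for s t
    unfolding \<phi>_def using that S_fin[of s] S_sets[of t] S_sets[of s]
    by (intro measure_mono_fmeasurable S_mono) (auto simp: fmeasurable_def)
  have g: "g \<in> borel_measurable borel"
  proof (rule borel_measurableI_greater)
    fix y
    show "{b \<in> space borel. y < g b} \<in> sets borel"
    proof (cases "y = 0 \<or> y = \<top>")
      case True
      have "{b. 0 < g b} = (\<Union>n. S (1 / Suc n))"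
      proof (intro equalityI subsetI)
        fix b assume "b \<in> {b. 0 < g b}"
        then obtain n where "ennreal (1 / Suc n) < g b"
        proof (cases "g b")
          case (real r)
          then have "0 < r" using \<open>b \<in> {b. 0 < g b}\<close> by auto
          then obtain n where "1 / Suc n < r" using nat_approx_posE by blast
          then show ?thesis using real that[of n] \<open>0 < r\<close> by (auto intro!: ennreal_lessI)
        qed (use that[of 0] in auto)
        then show "b \<in> (\<Union>n. S (1 / Suc n))" by (auto simp: S_def)
      qed (auto simp: S_def intro: le_less_trans[rotated])
      then have "{b. 0 < g b} \<in> sets borel" using S_sets by auto
      then show ?thesis using True by auto
    next
      case False
      then obtain t where "y = ennreal t" "0 < t" by (cases y) auto
      then show ?thesis using S_sets[of t] by (simp add: S_def)
    qed
  qed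
  \<comment> \<open>A level with non-null frontier charges \<open>{b. g b = ennreal t}\<close>,
    since \<open>N\<close> is null. If no level between \<open>a\<close> and \<open>b\<close> were
    good, the image under \<open>g\<close> of the finite measure on \<open>S a\<close> would have an
    atom at each of them, yet a finite measure has only countably many atoms.\<close>
  have good: "\<exists>t\<in>{a<..<b}. emeasure \<mu> (frontier (S t)) = 0" if ab: "0 < a" "a < b" for a b
  proof (rule ccontr)
    assume n: "\<not> ?thesis"
    define \<nu> where "\<nu> = distr (restrict_space \<mu> (S a)) borel g"
    have space_\<mu>: "space \<mu> = - {0}" using \<mu> by (simp add: radon_punctured_def sets_eq_imp_space_eq[of \<mu>] space_restrict_space)
    have Sa: "S a \<inter> space \<mu> \<in> sets \<mu>" "S a \<subseteq> space \<mu>" using S_sets[OF ab(1)] sets.sets_into_space by auto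
    have "g \<in> borel_measurable \<mu>"
    proof -
      have "g \<in> borel_measurable (restrict_space borel (- {0}))" by (rule measurable_restrict_space1[OF g])
      moreover have "sets \<mu> = sets (restrict_space borel (- {0}))" using \<mu> by (simp add: radon_punctured_def)
      ultimately show ?thesis using measurable_cong_sets by blast
    qed
    then have g': "g \<in> borel_measurable (restrict_space \<mu> (S a))" by (rule measurable_restrict_space1)
    have "finite_measure \<nu>"
    proof
      show "emeasure \<nu> (space \<nu>) \<noteq> \<infinity>"
        using S_fin[OF ab(1)] Sa g'
        by (simp add: \<nu>_def emeasure_distr space_restrict_space emeasure_restrict_space Int_absorb2)
    qed
    then have "countable {x. measure \<nu> {x} \<noteq> 0}" by (rule finite_measure.countable_support)
    moreover have "ennreal ` {a<..<b} \<subseteq> {x. measure \<nu> {x} \<noteq> 0}"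
    proof (intro subsetI CollectI)
      fix y assume "y \<in> ennreal ` {a<..<b}"
      then obtain t where t: "y = ennreal t" "a < t" "t < b" by auto
      define E where "E = {b. g b = ennreal t}"
      have ES: "E \<subseteq> S a" using t ab by (auto simp: E_def S_def ennreal_lessI)
      have Es: "E \<in> sets \<mu>" using g ES S_sets(1)[OF ab(1)]
        by (auto simp: E_def radon_punctured_sets[OF \<mu>])
      have "emeasure \<nu> {y} = emeasure \<mu> (g -` {y} \<inter> S a)"
        using Sa g' by (simp add: \<nu>_def emeasure_distr space_restrict_space emeasure_restrict_space Int_absorb2)
      also have "g -` {y} \<inter> S a = E" using ES t(1) by (auto simp: E_def)
      finally have eq: "emeasure \<nu> {y} = emeasure \<mu> E" .
      have "emeasure \<mu> (frontier (S t)) \<le> emeasure \<mu> (E \<union> N)"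
        using front[of t] t ab Es N by (intro emeasure_mono) (auto simp: E_def S_def)
      also have "\<dots> = emeasure \<mu> E" using Es N by (simp add: emeasure_Un_null_set)
      finally have "emeasure \<nu> {y} \<noteq> 0" using n t eq by auto
      then show "measure \<nu> {y} \<noteq> 0"
        using finite_measure.emeasure_eq_measure[OF \<open>finite_measure \<nu>\<close>, of "{y}"] by auto
    qed
    ultimately have "countable (ennreal ` {a<..<b})" by (rule countable_subset[rotated])
    moreover have "inj_on ennreal {a<..<b}" using ab by (auto simp: inj_on_def)
    ultimately have "countable {a<..<b}" by (rule countable_image_inj_on)
    then show False using uncountable_open_interval ab(2) by blast
  qed
  \<comment> \<open>The limit at a continuity level \<open>t\<close> is taken along
    \<open>x / t\<close>; regular variation turns \<open>tail G (x / t)\<close> into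
    \<open>tail G x\<close>. Since \<open>R\<close> does not involve \<open>t\<close>, the value
    \<open>\<phi> t * t powr \<alpha>\<close> is the same at all such levels.\<close>
  have limR: "(R \<longlongrightarrow> \<phi> t * t powr \<alpha>) at_top" if t: "0 < t" "emeasure \<mu> (frontier (S t)) = 0" for t
  proof -
    have eq: "measure V {z. embed z \<in> dilate x (S t)} = measure V {z. t * x < f z}" if x: "0 < x" for x
    proof -
      have "measure V {z. embed z \<in> dilate x (S t)} = measure V {z. embed ((1 / x) *\<^sub>R z) \<in> S t}"
      proof -
        \<comment> \<open>\<open>embed\<close> cuts negative components off, so with positive parts
          the rewriting holds for every \<open>z\<close>, not only in the quadrant. This exhibits
          the set as measurable, as the almost sure comparison below requires.\<close>
        have q: "{z. embed z \<in> dilate x (S t)} = {z. embed ((1 / x) *\<^sub>R (\<chi> j. max 0 (z $ j))) \<in> S t}"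
        proof -
          have "embed z = embed (\<chi> j. max 0 (z $ j))" for z :: "real ^ 'd"
            by (auto simp: embed_def vec_eq_iff max_def ennreal_neg)
          then show ?thesis
            using embed_mem_dilate_iff[OF x, of "\<chi> j. max 0 (z $ j)" "S t" for z] by (auto simp: quadrant_def)
        qed
        have mx: "(\<lambda>z::real^'d. \<chi> j. max 0 (z $ j)) \<in> borel_measurable borel"
          by (intro borel_measurable_continuous_onI continuous_on_vec_lambda continuous_intros)
        have m1: "{z. embed ((1 / x) *\<^sub>R (\<chi> j. max 0 (z $ j))) \<in> S t} \<in> sets borel"
          using measurable_sets_borel[OF measurable_compose[OF mx measurable_compose[OF _ embed_measurable]] S_sets(2)[OF t(1)], of "\<lambda>v. (1 / x) *\<^sub>R v"]
          by (simp add: vimage_def)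
        have m2: "{z. embed ((1 / x) *\<^sub>R z) \<in> S t} \<in> sets borel"
          using measurable_sets_borel[OF measurable_compose[OF _ embed_measurable] S_sets(2)[OF t(1)], of "\<lambda>v. (1 / x) *\<^sub>R v"]
          by (simp add: vimage_def)
        show ?thesis unfolding q
        proof (rule measure_eq_AE)
          show "AE z in V. z \<in> {z. embed ((1 / x) *\<^sub>R (\<chi> j. max 0 (z $ j))) \<in> S t} \<longleftrightarrow>
              z \<in> {z. embed ((1 / x) *\<^sub>R z) \<in> S t}"
            using quad
          proof eventually_elim
            case (elim z)
            then have "(\<chi> j. max 0 (z $ j)) = z" by (auto simp: quadrant_def vec_eq_iff max_def)
            then show ?case by simp
          qed
        qed (use m1 m2 V(2) in auto)
      qed
      also have "\<dots> = measure V {z. t * x < f z}"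
      proof (rule measure_eq_AE)
        show "AE z in V. z \<in> {z. embed ((1 / x) *\<^sub>R z) \<in> S t} \<longleftrightarrow> z \<in> {z. t * x < f z}"
          using quad by eventually_elim (use gf[OF _ x t(1)] in \<open>auto simp: S_def\<close>)
        show "{z. embed ((1 / x) *\<^sub>R z) \<in> S t} \<in> sets V"
          using measurable_sets_borel[OF measurable_compose[OF _ embed_measurable] S_sets(2)[OF t(1)], of "\<lambda>v. (1 / x) *\<^sub>R v"]
          by (simp add: vimage_def V(2))
      qed (simp add: V(2))
      finally show ?thesis .
    qed
    have "((\<lambda>x. measure V {z. embed z \<in> dilate x (S t)} / tail G x) \<longlongrightarrow> \<phi> t) at_top"
      unfolding \<phi>_def using t zero[OF t(1)] S_sets(2)[OF t(1)] by (intro lim) (auto simp: S_def)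
    then have "((\<lambda>x. measure V {z. t * x < f z} / tail G x) \<longlongrightarrow> \<phi> t) at_top"
      by (rule Lim_transform_eventually) (rule eventually_mono[OF eventually_gt_at_top[of 0]], simp add: eq)
    moreover have "filterlim (\<lambda>x. 1 / t * x) at_top at_top"
      using t by (intro filterlim_tendsto_pos_mult_at_top[OF tendsto_const] filterlim_ident) auto
    ultimately have "((\<lambda>x. measure V {z. t * (1 / t * x) < f z} / tail G (1 / t * x)) \<longlongrightarrow> \<phi> t) at_top"
      by (rule filterlim_compose)
    then have "((\<lambda>x. measure V {z. x < f z} / tail G (1 / t * x) * (tail G (1 / t * x) / tail G x))
        \<longlongrightarrow> \<phi> t * (1 / t) powr (-\<alpha>)) at_top"
      using t by (intro tendsto_mult regularly_varying_ratio[OF rv]) auto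
    moreover have "\<forall>\<^sub>F x in at_top. measure V {z. x < f z} / tail G (1 / t * x) * (tail G (1 / t * x) / tail G x) = R x"
      using eventually_ge_at_top[of 0]
    proof eventually_elim
      case (elim x)
      then have "0 < tail G (1 / t * x)"
        using rv t by (auto simp: regularly_varying_def halfline_distribution_def)
      then show ?case by (simp add: R_def)
    qed
    ultimately have "(R \<longlongrightarrow> \<phi> t * (1 / t) powr (-\<alpha>)) at_top" by (rule Lim_transform_eventually)
    then show ?thesis using t by (simp add: powr_divide powr_minus)
  qed
  obtain t0 where t0: "0 < t0" "emeasure \<mu> (frontier (S t0)) = 0" 
  proof -
    obtain t where "t \<in> {1<..<2}" "emeasure \<mu> (frontier (S t)) = 0" using good[of 1 2] by auto
    then show ?thesis using that[of t] by auto
  qed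
  define c where "c = \<phi> t0 * t0 powr \<alpha>"
  have c: "(R \<longlongrightarrow> c) at_top" unfolding c_def by (rule limR[OF t0])
  have c0: "0 \<le> c" by (simp add: c_def \<phi>_def)
  have \<phi>_good: "\<phi> t = c * t powr (-\<alpha>)" if "0 < t" "emeasure \<mu> (frontier (S t)) = 0" for t
    using tendsto_unique[OF _ c limR[OF that]] that by (simp add: powr_minus field_simps)
  have "\<phi> t = c * t powr (-\<alpha>)" if t: "0 < t" for t
  proof -
    have between: "\<exists>s\<in>{a<..<b}. \<phi> s = c * s powr (-\<alpha>)" if ab: "0 < a" "a < b" for a b
    proof -
      obtain s where s: "s \<in> {a<..<b}" "emeasure \<mu> (frontier (S s)) = 0" using good[OF ab] by blast
      then show ?thesis using \<phi>_good[of s] ab by auto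
    qed
    \<comment> \<open>The strict inequality makes \<open>\<phi>\<close> right-continuous, so an
      arbitrary level is reached from continuity levels above it.\<close>
    have St: "S t = (\<Union>n. S (t + 1 / Suc n))"
    proof (intro equalityI subsetI)
      fix b assume "b \<in> S t"
      then have gb: "ennreal t < g b" by (simp add: S_def)
      obtain n where "ennreal (t + 1 / Suc n) < g b"
      proof (cases "g b")
        case (real r)
        then have "0 < r - t" using gb t by (auto simp: ennreal_less_iff)
        then obtain n where "1 / Suc n < r - t" using nat_approx_posE by blast
        then have "t + 1 / Suc n < r" by simp
        moreover have "0 < t + 1 / Suc n" using t by (simp add: add_pos_pos)
        ultimately have "ennreal (t + 1 / Suc n) < ennreal r" by (intro ennreal_lessI) linarith+
        then show ?thesis using real that[of n] by simp
      qed (use that[of 0] in auto)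
      then show "b \<in> (\<Union>n. S (t + 1 / Suc n))" by (auto simp: S_def)
    next
      fix b assume "b \<in> (\<Union>n. S (t + 1 / Suc n))"
      then obtain n where "b \<in> S (t + 1 / real (Suc n))" by blast
      then show "b \<in> S t" using S_mono[of t "t + 1 / real (Suc n)"] by auto
    qed
    have "(\<lambda>n. \<phi> (t + 1 / Suc n)) \<longlonglongrightarrow> \<phi> t"
      unfolding \<phi>_def
    proof (subst St, rule Lim_measure_incseq)
      show "range (\<lambda>n. S (t + 1 / real (Suc n))) \<subseteq> sets \<mu>" using S_sets t by (auto simp: add_pos_pos)
      show "incseq (\<lambda>n. S (t + 1 / real (Suc n)))"
        by (auto intro!: incseq_SucI S_mono frac_le)
      show "emeasure \<mu> (\<Union>n. S (t + 1 / Suc n)) \<noteq> \<infinity>" using S_fin[OF t] St by auto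
    qed
    moreover have "(\<lambda>n. \<phi> (t + 1 / Suc n)) \<longlonglongrightarrow> c * t powr (-\<alpha>)"
    \<comment> \<open>A continuity level above \<open>t + 1 / Suc n\<close> but below
      \<open>t + 2 / Suc n\<close> bounds \<open>\<phi> (t + 1 / Suc n)\<close> from below, one
      between \<open>t\<close> and \<open>t + 1 / Suc n\<close> from above.\<close>
    proof (rule tendsto_sandwich)
      have "(\<lambda>n. c * (t + 2 / Suc n) powr (-\<alpha>)) \<longlonglongrightarrow> c * (t + 2 * 0) powr (-\<alpha>)"
        unfolding divide_inverse using t by (intro tendsto_intros LIMSEQ_inverse_real_of_nat) auto
      then show "(\<lambda>n. c * (t + 2 / Suc n) powr (-\<alpha>)) \<longlonglongrightarrow> c * t powr (-\<alpha>)" by simp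
      show "\<forall>\<^sub>F n in sequentially. c * (t + 2 / Suc n) powr (-\<alpha>) \<le> \<phi> (t + 1 / Suc n)"
      proof (intro always_eventually allI)
        fix n
        obtain s where s: "t + 1 / Suc n < s" "s < t + 2 / Suc n" "\<phi> s = c * s powr (-\<alpha>)"
          using between[of "t + 1 / Suc n" "t + 2 / Suc n"] t by (auto simp: add_pos_pos divide_strict_right_mono)
        have t1: "0 < t + 1 / Suc n" using t by (simp add: add_pos_pos)
        have "c * (t + 2 / Suc n) powr (-\<alpha>) \<le> c * s powr (-\<alpha>)"
          using c0 s t1 alpha by (intro mult_left_mono powr_mono2') auto
        also have "\<dots> \<le> \<phi> (t + 1 / Suc n)" using s t1 \<phi>_mono[of "t + 1 / Suc n" s] by simp
        finally show "c * (t + 2 / Suc n) powr (-\<alpha>) \<le> \<phi> (t + 1 / Suc n)" .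
      qed
      show "\<forall>\<^sub>F n in sequentially. \<phi> (t + 1 / Suc n) \<le> c * t powr (-\<alpha>)"
      proof (intro always_eventually allI)
        fix n
        obtain s where s: "t < s" "s < t + 1 / Suc n" "\<phi> s = c * s powr (-\<alpha>)"
          using between[of t "t + 1 / Suc n"] t by auto
        have "\<phi> (t + 1 / Suc n) \<le> c * s powr (-\<alpha>)" using s t \<phi>_mono[of s "t + 1 / Suc n"] by simp
        also have "\<dots> \<le> c * t powr (-\<alpha>)"
          using c0 s t alpha by (intro mult_left_mono powr_mono2') auto
        finally show "\<phi> (t + 1 / Suc n) \<le> c * t powr (-\<alpha>)" .
      qed
    qed (rule tendsto_const)
    ultimately show ?thesis by (rule LIMSEQ_unique)
  qed
  with c show ?thesis unfolding R_def \<phi>_def S_def by blast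
qed

text \<open>The level sets of one coordinate have mass \<open>c * t powr (-\<alpha>)\<close> and all
  contain the points where that coordinate is infinite; \<open>t \<rightarrow> \<infinity>\<close>
  leaves mass \<open>0\<close>. The coordinate itself is the level function here, so the exceptional
  set \<open>N\<close> is empty.\<close>

lemma MRV_infinite_null:
  fixes \<mu> :: "(ennreal ^ 'd) measure"
  assumes V: "V \<in> MRV \<alpha> \<mu> G" "sets V = sets borel" "prob_space V" and alpha: "0 < \<alpha>"
  shows "{b. \<exists>j. b $ j = \<top>} \<in> null_sets \<mu>"
proof -
  have \<mu>: "radon_punctured \<mu>" using V(1) by (simp add: MRV_def)
  have "{b. b $ j = \<top>} \<in> null_sets \<mu>" for j
  proof -
    define S where "S t = {b :: ennreal ^ 'd. ennreal t < b $ j}" for t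
    have op: "open (S t)" for t unfolding S_def by (intro open_Collect_less continuous_intros)
    have cl: "closure (S t) \<subseteq> {b. ennreal t \<le> b $ j}" for t
      unfolding S_def by (rule closure_minimal) (auto intro!: closed_Collect_le continuous_intros)
    have zero: "0 \<notin> closure (S t)" if "0 < t" for t using cl[of t] that by auto
    have front: "frontier (S t) \<subseteq> {b. b $ j = ennreal t} \<union> {}" for t
      using cl[of t] op[of t] by (auto simp: frontier_def interior_open S_def)
    have gf: "ennreal t < embed ((1 / x) *\<^sub>R z) $ j \<longleftrightarrow> t * x < z $ j"
      if "z \<in> quadrant" "0 < x" "0 < t" for z :: "real ^ 'd" and x t
      using that by (auto simp: embed_def ennreal_less_iff field_simps)
    obtain c where c: "\<And>t. 0 < t \<Longrightarrow> measure \<mu> (S t) = c * t powr (-\<alpha>)"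
      using MRV_level_sets[OF V alpha, of "\<lambda>b. b $ j" "{}" "\<lambda>z. z $ j"] op zero front gf
      unfolding S_def by auto
    have "closed {b :: ennreal ^ 'd. b $ j = \<top>}" by (intro closed_Collect_eq continuous_intros)
    then have E: "{b. b $ j = \<top>} \<in> sets \<mu>" by (auto simp: radon_punctured_sets[OF \<mu>])
    have sub: "{b. b $ j = \<top>} \<subseteq> S t" for t by (auto simp: S_def)
    have S: "S t \<in> fmeasurable \<mu>" if "0 < t" for t
      using radon_punctured_finite[OF \<mu> zero[OF that]] op[of t]
      by (auto simp: fmeasurable_def radon_punctured_sets[OF \<mu>] S_def)
    have "measure \<mu> {b. b $ j = \<top>} \<le> c * t powr (-\<alpha>)" if "0 < t" for t
      using measure_mono_fmeasurable[OF sub E S[OF that]] c[OF that] by simp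
    then have "\<forall>\<^sub>F t in at_top. measure \<mu> {b. b $ j = \<top>} \<le> c * t powr (-\<alpha>)"
      by (intro eventually_mono[OF eventually_gt_at_top[of 0]])
    moreover have "((\<lambda>t. c * t powr (-\<alpha>)) \<longlongrightarrow> c * 0) at_top"
      using alpha by (intro tendsto_mult tendsto_const tendsto_neg_powr filterlim_ident) auto
    ultimately have "measure \<mu> {b. b $ j = \<top>} \<le> 0"
      by (intro tendsto_lowerbound[of "\<lambda>t. c * t powr (-\<alpha>)" "c * 0" at_top, simplified]) auto
    moreover have "{b. b $ j = \<top>} \<in> fmeasurable \<mu>"
      by (rule fmeasurableI2[OF S[of 1] sub E]) auto
    ultimately show ?thesis
      using E emeasure_eq_measure2[of "{b. b $ j = \<top>}" \<mu>] by (auto simp: null_sets_def measure_le_0_iff)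
  qed
  then have "(\<Union>j. {b. b $ j = \<top>}) \<in> null_sets \<mu>" by (intro null_sets_UN') auto
  moreover have "(\<Union>j. {b :: ennreal ^ 'd. b $ j = \<top>}) = {b. \<exists>j. b $ j = \<top>}" by auto
  ultimately show ?thesis by simp
qed

text \<open>Applies the level-set lemma to \<open>reduct A\<close> transported to the compactified
  quadrant. The level \<open>t = 1\<close> identifies the constant, because that level set is the
  embedded part of \<open>A\<close> in the quadrant.\<close>

lemma MRV_reduct_tail:
  fixes A :: "(real ^ 'd) set"
  assumes A: "A \<in> class_R"
    and V: "V \<in> MRV \<alpha> \<mu> G" "sets V = sets borel" "prob_space V" and alpha: "0 < \<alpha>"
  shows "((\<lambda>x. measure V {z. x < reduct A z} / tail G x) \<longlongrightarrow> quadrant_measure \<mu> A) at_top"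
proof -
  define fin where "fin = {b :: ennreal ^ 'd. \<forall>j. b $ j < \<top>}"
  define r where "r b = (\<chi> j. enn2real (b $ j))" for b :: "ennreal ^ 'd"
  \<comment> \<open>The value \<open>0\<close> at points with an infinite coordinate keeps all
    positive level sets inside the open set \<open>fin\<close>. Their closures may still contain
    such points; these form the null set that is passed as \<open>N\<close>.\<close>
  define g where "g b = (if b \<in> fin then ennreal (reduct A (r b)) else 0)" for b
  define S where "S t = {b. ennreal t < g b}" for t
  have "fin = (\<Inter>j. {b. b $ j < \<top>})" by (auto simp: fin_def)
  moreover have "open \<dots>" by (intro open_INT ballI open_Collect_less continuous_intros) auto
  ultimately have fin: "open fin" by simp
  have "continuous_on fin (\<lambda>b. enn2real (b $ j))" for j
    unfolding continuous_on_def fin_def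
  proof
    fix b assume "b \<in> {b :: ennreal ^ 'd. \<forall>j. b $ j < \<top>}"
    then have "ennreal (enn2real (b $ j)) = b $ j" by auto
    then have "((\<lambda>b. b $ j) \<longlongrightarrow> ennreal (enn2real (b $ j))) (at b within {b. \<forall>j. b $ j < \<top>})"
      using tendsto_vec_nth[OF tendsto_ident_at] by metis
    then show "((\<lambda>b. enn2real (b $ j)) \<longlongrightarrow> enn2real (b $ j)) (at b within {b. \<forall>j. b $ j < \<top>})"
      by (rule tendsto_enn2real) simp
  qed
  then have r: "continuous_on fin r" unfolding r_def by (intro continuous_on_vec_lambda)
  have S_iff: "b \<in> S t \<longleftrightarrow> b \<in> fin \<and> (1 / t) *\<^sub>R r b \<in> A" if "0 < t" for b t
    using less_reduct_iff[OF A that, of "r b"] that by (auto simp: S_def g_def ennreal_less_iff)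
  have op: "open (S t)" if t: "0 < t" for t
  proof -
    have "S t = fin \<inter> (\<lambda>b. (1 / t) *\<^sub>R r b) -` A" using S_iff[OF t] by auto
    also have "open \<dots>"
      using fin class_RD(1)[OF A] by (intro continuous_open_preimage continuous_intros r) auto
    finally show ?thesis .
  qed
  have zero: "0 \<notin> closure (S t)" if t: "0 < t" for t
  proof -
    obtain e where e: "e > 0" "\<And>a. a \<in> A \<Longrightarrow> e \<le> norm a" using class_R_norm_bound[OF A] by blast
    \<comment> \<open>If every coordinate were below \<open>d\<close>, the l1-norm would be below
      \<open>t * e\<close>, whereas points of \<open>A\<close> have norm at least \<open>e\<close>.
      Closedness of \<open>K\<close> then passes the bound to the closure.\<close>
    define d where "d = t * e / CARD('d)"
    have d: "0 < d" using t e by (simp add: d_def)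
    define K where "K = {b :: ennreal ^ 'd. \<exists>j. ennreal d \<le> b $ j}"
    have "S t \<subseteq> K"
    proof
      fix b assume "b \<in> S t"
      then have b: "b \<in> fin" "(1 / t) *\<^sub>R r b \<in> A" using S_iff[OF t] by auto
      have "t * e \<le> norm (r b)" using e(2)[OF b(2)] t by (simp add: field_simps)
      also have "\<dots> \<le> (\<Sum>j\<in>UNIV. \<bar>r b $ j\<bar>)" by (rule norm_le_l1_cart)
      finally have *: "t * e \<le> (\<Sum>j\<in>UNIV. enn2real (b $ j))" by (simp add: r_def)
      have "\<exists>j. d \<le> enn2real (b $ j)"
      proof (rule ccontr)
        assume "\<not> ?thesis"
        then have "(\<Sum>j\<in>UNIV. enn2real (b $ j)) < (\<Sum>j\<in>(UNIV::'d set). d)"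
          by (intro sum_strict_mono) (auto simp: not_le)
        then show False using * by (simp add: d_def)
      qed
      then obtain j where "d \<le> enn2real (b $ j)" by blast
      moreover have "ennreal (enn2real (b $ j)) = b $ j" using b(1) by (auto simp: fin_def)
      ultimately have "ennreal d \<le> b $ j" by (metis ennreal_leI)
      then show "b \<in> K" by (auto simp: K_def)
    qed
    moreover have "K = (\<Union>j. {b. ennreal d \<le> b $ j})" by (auto simp: K_def)
    then have "closed K" by (auto intro!: closed_Collect_le continuous_intros)
    ultimately have "closure (S t) \<subseteq> K" by (rule closure_minimal)
    moreover have "0 \<notin> K" using d by (auto simp: K_def)
    ultimately show ?thesis by auto
  qed
  have front: "frontier (S t) \<subseteq> {b. g b = ennreal t} \<union> {b. \<exists>j. b $ j = \<top>}" if t: "0 < t" for t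
  proof
    fix b assume "b \<in> frontier (S t)"
    then have b: "b \<in> closure (S t)" "b \<notin> S t" using op[OF t] by (auto simp: frontier_def interior_open)
    show "b \<in> {b. g b = ennreal t} \<union> {b. \<exists>j. b $ j = \<top>}"
    proof (cases "b \<in> fin")
      case True
      define U where "U = fin \<inter> (\<lambda>b. (1 / t) *\<^sub>R r b) -` (- closure A)"
      have "open U" unfolding U_def
        using fin by (intro continuous_open_preimage continuous_intros r) auto
      moreover have "U \<inter> S t = {}" using S_iff[OF t] closure_subset[of A] by (auto simp: U_def)
      ultimately have "b \<notin> U" using b(1) open_Int_closure_eq_empty[of U "S t"] by auto
      then have cl: "(1 / t) *\<^sub>R r b \<in> closure A" using True by (simp add: U_def)
      have "t \<le> reduct A (r b)"
      proof (rule le_if_less_imp_le[OF reduct_nonneg[OF A]])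
        fix u assume u: "0 < u" "u < t"
        have "(t / u) *\<^sub>R ((1 / t) *\<^sub>R r b) \<in> A" using u t by (intro class_R_closure_scale[OF A cl]) auto
        then show "u \<le> reduct A (r b)" using less_reduct_iff[OF A u(1), of "r b"] t by simp
      qed
      then have "ennreal t \<le> g b" using True by (simp add: g_def ennreal_leI)
      then show ?thesis using b(2) by (auto simp: S_def)
    next
      case False
      then show ?thesis by (auto simp: fin_def less_top)
    qed
  qed
  have gf: "ennreal t < g (embed ((1 / x) *\<^sub>R z)) \<longleftrightarrow> t * x < reduct A z"
    if "z \<in> quadrant" "0 < x" "0 < t" for z x t
  proof -
    have "embed ((1 / x) *\<^sub>R z) \<in> fin" by (simp add: fin_def embed_def)
    moreover have "r (embed ((1 / x) *\<^sub>R z)) = (1 / x) *\<^sub>R z"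
      using that by (simp add: r_def embed_def vec_eq_iff quadrant_def)
    ultimately have "ennreal t < g (embed ((1 / x) *\<^sub>R z)) \<longleftrightarrow> t < 1 / x * reduct A z"
      using that reduct_scaleR[OF A, of "1 / x" z] by (simp add: g_def ennreal_less_iff)
    then show ?thesis using that by (simp add: field_simps)
  qed
  obtain c where c: "\<And>t. 0 < t \<Longrightarrow> measure \<mu> (S t) = c * t powr (-\<alpha>)"
      "((\<lambda>x. measure V {z. x < reduct A z} / tail G x) \<longlongrightarrow> c) at_top"
    using MRV_level_sets[OF V alpha _ _ _ MRV_infinite_null[OF V alpha] reduct_measurable[OF A] gf]
      op zero front unfolding S_def by blast
  have "embed ` (A \<inter> quadrant) = S 1"
  proof (intro equalityI subsetI)
    fix b assume "b \<in> embed ` (A \<inter> quadrant)"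
    then obtain z where z: "b = embed z" "z \<in> A" "z \<in> quadrant" by auto
    then show "b \<in> S 1"
      using gf[of z 1 1] less_reduct_iff[OF A, of 1 z] by (simp add: S_def)
  next
    fix b assume "b \<in> S 1"
    then have b: "b \<in> fin" "r b \<in> A" using S_iff[of 1 b] by auto
    have "b = embed (r b)" using b(1) by (simp add: embed_def r_def vec_eq_iff fin_def)
    moreover have "r b \<in> quadrant" by (simp add: r_def quadrant_def)
    ultimately show "b \<in> embed ` (A \<inter> quadrant)" using b(2) by blast
  qed
  then have "quadrant_measure \<mu> A = c" using c(1)[of 1] by (simp add: quadrant_measure_def)
  then show ?thesis using c(2) by simp
qed

section \<open>The renewal process\<close>

lemma renewal_interarrivalsD:
  assumes "renewal_interarrivals M \<theta>"
  shows "prob_space.indep_vars M (\<lambda>_. borel) \<theta> {1..}"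
    "\<And>i. 1 \<le> i \<Longrightarrow> distr M borel (\<theta> i) = distr M borel (\<theta> 1)"
    "\<And>i \<omega>. 1 \<le> i \<Longrightarrow> \<omega> \<in> space M \<Longrightarrow> 0 \<le> \<theta> i \<omega>"
    "\<not> (AE \<omega> in M. \<theta> 1 \<omega> = 0)"
  using assms unfolding renewal_interarrivals_def by blast+

lemma arrival_mono:
  assumes "renewal_interarrivals M \<theta>" "\<omega> \<in> space M" "i \<le> j"
  shows "arrival \<theta> i \<omega> \<le> arrival \<theta> j \<omega>"
  unfolding arrival_def using assms renewal_interarrivalsD(3)[OF assms(1)] by (intro sum_mono2) auto

lemma arrival_nonneg:
  assumes "renewal_interarrivals M \<theta>" "\<omega> \<in> space M"
  shows "0 \<le> arrival \<theta> i \<omega>"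
  unfolding arrival_def using assms renewal_interarrivalsD(3)[OF assms(1)] by (intro sum_nonneg) auto

text \<open>Counting and arrival events determine each other. The supremum yields a witness only
  below a strict inequality, hence the passage to the predecessor \<open>m\<close>; monotone
  arrivals then reduce the witness to \<open>i\<close>.\<close>

lemma claim_count_ge_iff:
  assumes "renewal_interarrivals M \<theta>" "\<omega> \<in> space M" "1 \<le> i"
  shows "enat i \<le> claim_count \<theta> t \<omega> \<longleftrightarrow> arrival \<theta> i \<omega> \<le> t"
proof -
  obtain m where m: "i = Suc m" using assms(3) by (cases i) auto
  have "enat i \<le> claim_count \<theta> t \<omega> \<longleftrightarrow> enat m < claim_count \<theta> t \<omega>" by (simp add: m Suc_ile_eq)
  also have "\<dots> \<longleftrightarrow> (\<exists>j. 1 \<le> j \<and> arrival \<theta> j \<omega> \<le> t \<and> i \<le> j)"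
    by (auto simp: claim_count_def less_Sup_iff m Suc_le_eq)
  also have "\<dots> \<longleftrightarrow> arrival \<theta> i \<omega> \<le> t"
    using arrival_mono[OF assms(1,2)] assms(3) by (auto intro: order_trans)
  finally show ?thesis .
qed

lemma summable_power_times_geometric:
  fixes \<rho> :: real
  assumes "0 \<le> \<rho>" "\<rho> < 1"
  shows "summable (\<lambda>n. real n ^ m * \<rho> ^ n)"
proof -
  have "(\<lambda>n. (real (Suc n) / real n) ^ m * \<rho>) \<longlonglongrightarrow> 1 ^ m * \<rho>"
    by (intro tendsto_intros LIMSEQ_Suc_n_over_n)
  then have "\<forall>\<^sub>F n in sequentially. (real (Suc n) / real n) ^ m * \<rho> < (1 + \<rho>) / 2"
    using assms by (intro order_tendstoD(2)) auto
  then have "\<forall>\<^sub>F n in sequentially. 0 < n \<and> (real (Suc n) / real n) ^ m * \<rho> < (1 + \<rho>) / 2"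
    by (intro eventually_conj eventually_gt_at_top)
  then obtain N where N: "\<And>n. N \<le> n \<Longrightarrow> 0 < n \<and> (real (Suc n) / real n) ^ m * \<rho> < (1 + \<rho>) / 2"
    by (auto simp: eventually_sequentially)
  show ?thesis
  proof (rule summable_ratio_test)
    show "(1 + \<rho>) / 2 < 1" using assms by simp
    fix n assume "N \<le> n"
    note n = N[OF this]
    have "real (Suc n) ^ m * \<rho> ^ Suc n = ((real (Suc n) / real n) ^ m * \<rho>) * (real n ^ m * \<rho> ^ n)"
      using n by (simp add: power_divide)
    also have "\<dots> \<le> (1 + \<rho>) / 2 * (real n ^ m * \<rho> ^ n)"
      using n assms by (intro mult_right_mono) auto
    finally show "norm (real (Suc n) ^ m * \<rho> ^ Suc n) \<le> (1 + \<rho>) / 2 * norm (real n ^ m * \<rho> ^ n)"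
      using assms by simp
  qed
qed

lemma sets_renewal_measure [simp]: "sets (renewal_measure M \<theta>) = sets borel"
  using sets.sigma_sets_eq[of "borel :: real measure"] by (simp add: renewal_measure_def)

context prob_space
begin

lemma interarrival_measurable:
  assumes "renewal_interarrivals M \<theta>" "1 \<le> i"
  shows "\<theta> i \<in> borel_measurable M"
  using renewal_interarrivalsD(1)[OF assms(1)] assms(2) by (auto simp: indep_vars_def)

lemma arrival_measurable:
  assumes "renewal_interarrivals M \<theta>"
  shows "arrival \<theta> i \<in> borel_measurable M"
  unfolding arrival_def[abs_def] using interarrival_measurable[OF assms] by (intro borel_measurable_sum) auto

text \<open>A Chernoff bound: \<open>\<rho>\<close> is the Laplace transform of an inter-arrival time at \<open>1\<close>.\<close>

lemma arrival_prob_le: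
  assumes r: "renewal_interarrivals M \<theta>"
  shows "\<exists>\<rho>. 0 \<le> \<rho> \<and> \<rho> < 1 \<and> (\<forall>n t. prob {\<omega> \<in> space M. arrival \<theta> n \<omega> \<le> t} \<le> exp t * \<rho> ^ n)"
proof -
  note [measurable] = interarrival_measurable[OF r] arrival_measurable[OF r]
  have \<theta>1 [measurable]: "\<theta> 1 \<in> borel_measurable M" by (rule interarrival_measurable[OF r]) simp
  define \<rho> where "\<rho> = expectation (\<lambda>\<omega>. exp (- \<theta> 1 \<omega>))"
  have int: "integrable M (\<lambda>\<omega>. exp (- \<theta> 1 \<omega>))"
    using renewal_interarrivalsD(3)[OF r, of 1] by (intro integrable_const_bound[of _ 1]) auto
  have \<rho>0: "0 \<le> \<rho>" unfolding \<rho>_def by simp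
  \<comment> \<open>This is where inter-arrival times that vanish almost surely are excluded:
    \<open>\<rho> \<ge> 1\<close> would force \<open>exp (- \<theta> 1)\<close> to be
    \<open>1\<close> almost surely.\<close>
  have "\<rho> < 1"
  proof (rule ccontr)
    assume "\<not> \<rho> < 1"
    have nn: "AE \<omega> in M. 0 \<le> 1 - exp (- \<theta> 1 \<omega>)" using renewal_interarrivalsD(3)[OF r, of 1] by (intro AE_I2) auto
    have "expectation (\<lambda>\<omega>. 1 - exp (- \<theta> 1 \<omega>)) = 1 - \<rho>" using int by (simp add: \<rho>_def prob_space)
    moreover have "0 \<le> expectation (\<lambda>\<omega>. 1 - exp (- \<theta> 1 \<omega>))" using nn by (rule integral_nonneg_AE)
    ultimately have "expectation (\<lambda>\<omega>. 1 - exp (- \<theta> 1 \<omega>)) = 0" using \<open>\<not> \<rho> < 1\<close> by simp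
    then have "AE \<omega> in M. 1 - exp (- \<theta> 1 \<omega>) = 0"
      using integral_nonneg_eq_0_iff_AE[OF _ nn] int by simp
    then have "AE \<omega> in M. \<theta> 1 \<omega> = 0" by eventually_elim simp
    then show False using renewal_interarrivalsD(4)[OF r] by simp
  qed
  moreover have "prob {\<omega> \<in> space M. arrival \<theta> n \<omega> \<le> t} \<le> exp t * \<rho> ^ n" for n t
  proof -
    have one: "(\<integral>\<^sup>+\<omega>. ennreal (exp (- \<theta> k \<omega>)) \<partial>M) = ennreal \<rho>" if "1 \<le> k" for k
    proof -
      have [measurable]: "\<theta> k \<in> borel_measurable M" by (rule interarrival_measurable[OF r that])
      have "(\<integral>\<^sup>+\<omega>. ennreal (exp (- \<theta> k \<omega>)) \<partial>M) = (\<integral>\<^sup>+x. ennreal (exp (- x)) \<partial>distr M borel (\<theta> k))"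
        by (subst nn_integral_distr) auto
      also have "\<dots> = (\<integral>\<^sup>+\<omega>. ennreal (exp (- \<theta> 1 \<omega>)) \<partial>M)"
        unfolding renewal_interarrivalsD(2)[OF r that] by (subst nn_integral_distr) auto
      also have "\<dots> = ennreal \<rho>" unfolding \<rho>_def using int by (intro nn_integral_eq_integral) auto
      finally show ?thesis .
    qed
    have "emeasure M {\<omega> \<in> space M. arrival \<theta> n \<omega> \<le> t} = (\<integral>\<^sup>+\<omega>. indicator {\<omega> \<in> space M. arrival \<theta> n \<omega> \<le> t} \<omega> \<partial>M)"
      by simp
    also have "\<dots> \<le> (\<integral>\<^sup>+\<omega>. ennreal (exp t) * (\<Prod>k\<in>{1..n}. ennreal (exp (- \<theta> k \<omega>))) \<partial>M)"
    proof (rule nn_integral_mono)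
      fix \<omega>
      have "ennreal (exp t) * (\<Prod>k\<in>{1..n}. ennreal (exp (- \<theta> k \<omega>))) = ennreal (exp (t - arrival \<theta> n \<omega>))"
        by (simp add: prod_ennreal exp_sum[symmetric] sum_negf arrival_def ennreal_mult[symmetric] exp_add[symmetric])
      then show "indicator {\<omega> \<in> space M. arrival \<theta> n \<omega> \<le> t} \<omega> \<le>
          ennreal (exp t) * (\<Prod>k\<in>{1..n}. ennreal (exp (- \<theta> k \<omega>)))"
        by (auto simp: indicator_def)
    qed
    also have "\<dots> = ennreal (exp t) * (\<integral>\<^sup>+\<omega>. (\<Prod>k\<in>{1..n}. ennreal (exp (- \<theta> k \<omega>))) \<partial>M)"
      using interarrival_measurable[OF r] by (intro nn_integral_cmult borel_measurable_prod_ennreal) auto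
    also have "(\<integral>\<^sup>+\<omega>. (\<Prod>k\<in>{1..n}. ennreal (exp (- \<theta> k \<omega>))) \<partial>M) = (\<Prod>k\<in>{1..n}. ennreal \<rho>)"
    proof (subst indep_vars_nn_integral)
      show "indep_vars (\<lambda>_. borel) (\<lambda>k \<omega>. ennreal (exp (- \<theta> k \<omega>))) {1..n}"
        by (rule indep_vars_compose2[OF indep_vars_subset[OF renewal_interarrivalsD(1)[OF r]]]) auto
    qed (auto simp: one)
    also have "ennreal (exp t) * (\<Prod>k\<in>{1..n}. ennreal \<rho>) = ennreal (exp t * \<rho> ^ n)"
      using \<rho>0 by (simp add: ennreal_mult ennreal_power)
    finally show ?thesis using \<rho>0 by (simp add: emeasure_eq_measure)
  qed
  ultimately show ?thesis using \<rho>0 by blast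
qed

text \<open>An infinite count means that all arrivals occur by time \<open>t\<close>, an event of
  probability at most \<open>exp t * \<rho> ^ n\<close> for every \<open>n\<close>.\<close>

lemma claim_count_finite_AE:
  assumes r: "renewal_interarrivals M \<theta>"
  shows "AE \<omega> in M. claim_count \<theta> t \<omega> \<noteq> \<infinity>"
proof -
  note [measurable] = arrival_measurable[OF r]
  obtain \<rho> where \<rho>: "0 \<le> \<rho>" "\<rho> < 1" "\<And>n t. prob {\<omega> \<in> space M. arrival \<theta> n \<omega> \<le> t} \<le> exp t * \<rho> ^ n"
    using arrival_prob_le[OF r] by blast
  define B where "B = (\<Inter>n. {\<omega> \<in> space M. arrival \<theta> (Suc n) \<omega> \<le> t})"
  have B: "B \<in> events" unfolding B_def by (intro sets.countable_INT) auto
  have "prob B \<le> exp t * \<rho> ^ Suc n" for n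
  proof -
    have "prob B \<le> prob {\<omega> \<in> space M. arrival \<theta> (Suc n) \<omega> \<le> t}"
      by (intro finite_measure_mono) (auto simp: B_def)
    then show ?thesis using \<rho>(3)[of "Suc n" t] by simp
  qed
  moreover have "(\<lambda>n. exp t * \<rho> ^ Suc n) \<longlonglongrightarrow> exp t * 0"
    using \<rho> by (intro tendsto_mult tendsto_const LIMSEQ_Suc[OF LIMSEQ_realpow_zero])
  ultimately have "prob B \<le> 0" by (intro LIMSEQ_le_const[of "\<lambda>n. exp t * \<rho> ^ Suc n"]) auto
  then have "AE \<omega> in M. \<omega> \<notin> B"
    using B by (intro AE_not_in) (auto simp: null_sets_def emeasure_eq_measure measure_le_0_iff)
  then show ?thesis
  proof (rule AE_mp, intro AE_I2 impI)
    fix \<omega> assume om: "\<omega> \<in> space M" "\<omega> \<notin> B"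
    then obtain n where "\<not> arrival \<theta> (Suc n) \<omega> \<le> t" by (auto simp: B_def)
    then have "\<not> enat (Suc n) \<le> claim_count \<theta> t \<omega>" using claim_count_ge_iff[OF r om(1), of "Suc n" t] by simp
    then show "claim_count \<theta> t \<omega> \<noteq> \<infinity>" by (metis enat_ord_code(3))
  qed
qed

text \<open>The power at the value \<open>N\<close> is one term of the series over all
  \<open>n\<close> with \<open>arrival \<theta> n \<le> t\<close>, so the Chernoff bound and
  summability finish. The exponent \<open>Suc m\<close> makes the case of no claims trivial.\<close>

lemma claim_count_moment:
  assumes r: "renewal_interarrivals M \<theta>" and \<nu>: "(\<lambda>\<omega>. the_enat (claim_count \<theta> t \<omega>)) \<in> measurable M (count_space UNIV)"
  shows "integrable M (\<lambda>\<omega>. real (the_enat (claim_count \<theta> t \<omega>)) ^ Suc m)"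
proof -
  note [measurable] = arrival_measurable[OF r]
  define N where "N \<omega> = the_enat (claim_count \<theta> t \<omega>)" for \<omega>
  have [measurable]: "N \<in> measurable M (count_space UNIV)" using \<nu> by (simp add: N_def[abs_def])
  obtain \<rho> where \<rho>: "0 \<le> \<rho>" "\<rho> < 1" "\<And>n t. prob {\<omega> \<in> space M. arrival \<theta> n \<omega> \<le> t} \<le> exp t * \<rho> ^ n"
    using arrival_prob_le[OF r] by blast
  define a where "a n = real n ^ Suc m * (exp t * \<rho> ^ n)" for n
  have a: "summable a" "\<And>n. 0 \<le> a n"
  proof -
    have "summable (\<lambda>n. exp t * (real n ^ Suc m * \<rho> ^ n))"
      by (intro summable_mult summable_power_times_geometric \<rho>(1,2))
    then show "summable a" by (simp add: a_def[abs_def] mult_ac)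
  qed (use \<rho> in \<open>simp add: a_def\<close>)
  have "(\<integral>\<^sup>+\<omega>. ennreal (real (N \<omega>) ^ Suc m) \<partial>M)
      \<le> (\<integral>\<^sup>+\<omega>. (\<Sum>n. ennreal (real n ^ Suc m) * indicator {\<omega> \<in> space M. arrival \<theta> n \<omega> \<le> t} \<omega>) \<partial>M)"
    (is "_ \<le> (\<integral>\<^sup>+\<omega>. (\<Sum>n. ?f n \<omega>) \<partial>M)")
  proof (rule nn_integral_mono_AE)
    show "AE \<omega> in M. ennreal (real (N \<omega>) ^ Suc m) \<le> (\<Sum>n. ?f n \<omega>)"
      using claim_count_finite_AE[OF r, of t] AE_space
    proof eventually_elim
      case (elim \<omega>)
      show ?case
      proof (cases "N \<omega> = 0")
        case False
        then have "1 \<le> N \<omega>" "enat (N \<omega>) \<le> claim_count \<theta> t \<omega>" using elim by (auto simp: N_def)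
        then have "arrival \<theta> (N \<omega>) \<omega> \<le> t" using claim_count_ge_iff[OF r elim(2)] by blast
        then have "ennreal (real (N \<omega>) ^ Suc m) = (\<Sum>n\<in>{N \<omega>}. ?f n \<omega>)" using elim by simp
        also have "\<dots> \<le> (\<Sum>n. ?f n \<omega>)" by (intro sum_le_suminf) auto
        finally show ?thesis .
      qed simp
    qed
  qed
  also have "\<dots> = (\<Sum>n. \<integral>\<^sup>+\<omega>. ?f n \<omega> \<partial>M)" by (intro nn_integral_suminf) auto
  also have "\<dots> \<le> (\<Sum>n. ennreal (a n))"
  proof (rule suminf_le)
    fix n
    have "(\<integral>\<^sup>+\<omega>. ?f n \<omega> \<partial>M) = ennreal (real n ^ Suc m) * ennreal (prob {\<omega> \<in> space M. arrival \<theta> n \<omega> \<le> t})"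
      by (subst nn_integral_cmult_indicator) (auto simp: emeasure_eq_measure)
    also have "\<dots> \<le> ennreal (a n)"
      unfolding a_def using \<rho>(3)[of n t] by (auto simp: ennreal_mult[symmetric] intro!: ennreal_leI mult_left_mono)
    finally show "(\<integral>\<^sup>+\<omega>. ?f n \<omega> \<partial>M) \<le> ennreal (a n)" .
  qed auto
  also have "\<dots> = ennreal (\<Sum>n. a n)" using a by (intro suminf_ennreal2) auto
  also have "\<dots> < \<infinity>" by simp
  finally show ?thesis
    unfolding N_def[symmetric] by (intro integrableI_nonneg) auto
qed

text \<open>Campbell's formula. The set function in the definition is recognised as the image of
  counting measure times \<open>M\<close> under
  \<open>(i, \<omega>) \<mapsto> arrival \<theta> (Suc i) \<omega>\<close>; this shows that it is a
  measure and reduces the integral to Tonelli's theorem.\<close>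

lemma nn_integral_renewal_measure:
  assumes r: "renewal_interarrivals M \<theta>" and f [measurable]: "f \<in> borel_measurable borel"
  shows "(\<integral>\<^sup>+s. f s \<partial>renewal_measure M \<theta>) = (\<Sum>i. \<integral>\<^sup>+\<omega>. f (arrival \<theta> (Suc i) \<omega>) \<partial>M)"
proof -
  note [measurable] = arrival_measurable[OF r]
  define P where "P = count_space (UNIV :: nat set) \<Otimes>\<^sub>M M"
  define h where "h = (\<lambda>(i, \<omega>). arrival \<theta> (Suc i) \<omega>)"
  have h [measurable]: "h \<in> measurable P borel"
    unfolding P_def h_def by (intro measurable_pair_measure_countable1) auto
  have fub: "(\<integral>\<^sup>+s. g s \<partial>distr P borel h) = (\<Sum>i. \<integral>\<^sup>+\<omega>. g (arrival \<theta> (Suc i) \<omega>) \<partial>M)"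
    if [measurable]: "g \<in> borel_measurable borel" for g
  proof -
    have "(\<integral>\<^sup>+s. g s \<partial>distr P borel h) = (\<integral>\<^sup>+z. g (h z) \<partial>P)" by (rule nn_integral_distr) auto
    also have "\<dots> = (\<integral>\<^sup>+i. \<integral>\<^sup>+\<omega>. g (h (i, \<omega>)) \<partial>M \<partial>count_space UNIV)"
    proof -
      have "(\<lambda>z. g (h z)) \<in> borel_measurable (count_space (UNIV :: nat set) \<Otimes>\<^sub>M M)"
        using measurable_compose[OF h that] by (simp add: P_def)
      from nn_integral_fst[OF this] show ?thesis by (simp add: P_def)
    qed
    finally show ?thesis by (simp add: nn_integral_count_space_nat h_def)
  qed
  have "renewal_measure M \<theta> = measure_of UNIV (sets borel) (emeasure (distr P borel h))"
    unfolding renewal_measure_def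
  proof (rule measure_of_eq)
    fix B :: "real set" assume "B \<in> sigma_sets UNIV (sets borel)"
    then have [measurable]: "B \<in> sets borel" using sets.sigma_sets_eq[of "borel :: real measure"] by simp
    have "(\<Sum>i. emeasure (distr M borel (arrival \<theta> (Suc i))) B) = (\<Sum>i. \<integral>\<^sup>+\<omega>. indicator B (arrival \<theta> (Suc i) \<omega>) \<partial>M)"
    proof (intro suminf_cong)
      fix i
      have "emeasure (distr M borel (arrival \<theta> (Suc i))) B = (\<integral>\<^sup>+x. indicator B x \<partial>distr M borel (arrival \<theta> (Suc i)))"
        by simp
      also have "\<dots> = (\<integral>\<^sup>+\<omega>. indicator B (arrival \<theta> (Suc i) \<omega>) \<partial>M)" by (rule nn_integral_distr) auto
      finally show "emeasure (distr M borel (arrival \<theta> (Suc i))) B = (\<integral>\<^sup>+\<omega>. indicator B (arrival \<theta> (Suc i) \<omega>) \<partial>M)" .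
    qed
    also have "\<dots> = (\<integral>\<^sup>+s. indicator B s \<partial>distr P borel h)" by (rule fub[symmetric]) auto
    finally show "(\<Sum>i. emeasure (distr M borel (arrival \<theta> (Suc i))) B) = emeasure (distr P borel h) B" by simp
  qed auto
  also have "\<dots> = distr P borel h"
    using measure_of_of_measure[of "distr P borel h"] by simp
  finally show ?thesis using fub[OF f] by simp
qed

end

section \<open>Independence of the driving processes\<close>

text \<open>A generated \<sigma>-algebra packaged as a measure space, so that measurability with
  respect to it can be stated; only its space and its events matter.\<close>

definition process_space ::
    "'a measure \<Rightarrow> 'b measure \<Rightarrow> 'i set \<Rightarrow> ('i \<Rightarrow> 'a \<Rightarrow> 'b) \<Rightarrow> 'a measure" where
  "process_space M M' I Z = sigma (space M) (process_events M M' I Z)"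

lemma process_events_sub: "process_events M M' I Z \<subseteq> Pow (space M)"
proof
  fix E assume "E \<in> process_events M M' I Z"
  then have "E \<subseteq> space M"
    unfolding process_events_def by (rule sigma_sets_into_sp[rotated]) auto
  then show "E \<in> Pow (space M)" by simp
qed

lemma space_process_space [simp]: "space (process_space M M' I Z) = space M"
  by (simp add: process_space_def space_measure_of[OF process_events_sub])

lemma sets_process_space [simp]: "sets (process_space M M' I Z) = process_events M M' I Z"
proof -
  have "sets (process_space M M' I Z) = sigma_sets (space M) (process_events M M' I Z)"
    by (simp add: process_space_def sets_measure_of[OF process_events_sub])
  also have "\<dots> = process_events M M' I Z"
    unfolding process_events_def by (intro sigma_sets_sigma_sets_eq) auto
  finally show ?thesis .
qed

lemma measurable_process_space:
  assumes "i \<in> I" "Z i \<in> space M \<rightarrow> space M'"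
  shows "Z i \<in> measurable (process_space M M' I Z) M'"
  using assms by (intro measurableI) (auto simp: process_events_def intro!: sigma_sets.Basic)

text \<open>Serves to merge arrivals and returns into one block that is independent of the claims,
  and to single out the pair of returns and arrivals.\<close>

lemma (in prob_space) indep_set_sigma_Un:
  assumes indep: "indep_sets F K" and IJ: "I \<union> J \<subseteq> K" "I \<inter> J = {}"
    and stable: "\<And>k. k \<in> K \<Longrightarrow> Int_stable (F k)"
  shows "indep_set (sigma_sets (space M) (\<Union>k\<in>I. F k)) (sigma_sets (space M) (\<Union>k\<in>J. F k))"
proof -
  have "indep_sets (\<lambda>b. sigma_sets (space M) (\<Union>k\<in>(if b then I else J). F k)) (UNIV :: bool set)"
  proof (rule indep_sets_collect_sigma)
    show "indep_sets F (\<Union>b\<in>UNIV. if b then I else J)"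
      using IJ by (intro indep_sets_mono_index[OF _ indep]) (auto simp: UNIV_bool)
    show "disjoint_family_on (\<lambda>b. if b then I else J) UNIV"
      using IJ(2) by (auto simp: disjoint_family_on_def)
  qed (use stable IJ in \<open>auto split: if_splits\<close>)
  then show ?thesis
    unfolding indep_set_def
    by (rule indep_sets_cong[THEN iffD1, OF refl, rotated]) (simp split: bool.split)
qed

text \<open>Independence means that the diagonal map into the product of the two spaces has the product law.\<close>

lemma (in prob_space) indep_set_nn_integral:
  assumes indep: "indep_set (sets N1) (sets N2)" and sp: "space N1 = space M" "space N2 = space M"
    and f: "f \<in> borel_measurable (N1 \<Otimes>\<^sub>M N2)"
  shows "(\<integral>\<^sup>+\<omega>. f (\<omega>, \<omega>) \<partial>M) = (\<integral>\<^sup>+\<omega>2. (\<integral>\<^sup>+\<omega>1. f (\<omega>1, \<omega>2) \<partial>M) \<partial>M)"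
proof -
  \<comment> \<open>The identity, read as a random variable with values in the coarser space, turns
    independence of the \<sigma>-algebras into independence of two variables.\<close>
  have id1: "(\<lambda>\<omega>. \<omega>) \<in> measurable M N1"
    using indep_setD_ev1[OF indep] sp sets.sets_into_space[of _ N1]
    by (intro measurableI) (auto simp: Int_absorb2 subset_iff)
  have id2: "(\<lambda>\<omega>. \<omega>) \<in> measurable M N2"
    using indep_setD_ev2[OF indep] sp sets.sets_into_space[of _ N2]
    by (intro measurableI) (auto simp: Int_absorb2 subset_iff)
  have vim: "{(\<lambda>\<omega>. \<omega>) -` A \<inter> space M |A. A \<in> sets N} = sets N" if "space N = space M" for N :: "'a measure"
  proof -
    have "(\<lambda>\<omega>. \<omega>) -` A \<inter> space M = A" if "A \<in> sets N" for A
      using sets.sets_into_space[OF that] \<open>space N = space M\<close> by auto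
    then show ?thesis by auto
  qed
  have sig: "sigma_sets (space M) (sets N) = sets N" if "space N = space M" for N :: "'a measure"
    using sets.sigma_sets_eq[of N] that by simp
  have "indep_var N1 (\<lambda>\<omega>. \<omega>) N2 (\<lambda>\<omega>. \<omega>)"
    unfolding indep_var_eq vim[OF sp(1)] vim[OF sp(2)] sig[OF sp(1)] sig[OF sp(2)]
    using indep id1 id2 by blast
  then have law: "distr M N1 (\<lambda>\<omega>. \<omega>) \<Otimes>\<^sub>M distr M N2 (\<lambda>\<omega>. \<omega>) = distr M (N1 \<Otimes>\<^sub>M N2) (\<lambda>\<omega>. (\<omega>, \<omega>))"
    unfolding indep_var_distribution_eq by blast
  interpret P1: prob_space "distr M N1 (\<lambda>\<omega>. \<omega>)" by (rule prob_space_distr[OF id1])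
  interpret P2: prob_space "distr M N2 (\<lambda>\<omega>. \<omega>)" by (rule prob_space_distr[OF id2])
  interpret P: pair_prob_space "distr M N1 (\<lambda>\<omega>. \<omega>)" "distr M N2 (\<lambda>\<omega>. \<omega>)" ..
  have f': "f \<in> borel_measurable (distr M N1 (\<lambda>\<omega>. \<omega>) \<Otimes>\<^sub>M distr M N2 (\<lambda>\<omega>. \<omega>))"
    using f by (simp cong: measurable_cong_sets)
  have "(\<integral>\<^sup>+\<omega>. f (\<omega>, \<omega>) \<partial>M) = (\<integral>\<^sup>+z. f z \<partial>distr M (N1 \<Otimes>\<^sub>M N2) (\<lambda>\<omega>. (\<omega>, \<omega>)))"
    using f id1 id2 by (subst nn_integral_distr) auto
  also have "\<dots> = (\<integral>\<^sup>+\<omega>2. (\<integral>\<^sup>+\<omega>1. f (\<omega>1, \<omega>2) \<partial>distr M N1 (\<lambda>\<omega>. \<omega>)) \<partial>distr M N2 (\<lambda>\<omega>. \<omega>))"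
    unfolding law[symmetric] by (rule P.nn_integral_snd[symmetric]) (use f' in simp)
  also have "\<dots> = (\<integral>\<^sup>+\<omega>2. (\<integral>\<^sup>+\<omega>1. f (\<omega>1, \<omega>2) \<partial>distr M N1 (\<lambda>\<omega>. \<omega>)) \<partial>M)"
    using P1.borel_measurable_nn_integral[of "\<lambda>\<omega>2 \<omega>1. f (\<omega>1, \<omega>2)" N2] f
    by (intro nn_integral_distr id2) (auto cong: measurable_cong_sets)
  also have "\<dots> = (\<integral>\<^sup>+\<omega>2. (\<integral>\<^sup>+\<omega>1. f (\<omega>1, \<omega>2) \<partial>M) \<partial>M)"
    using sp by (intro nn_integral_cong nn_integral_distr id1 measurable_compose[OF _ f]) auto
  finally show ?thesis .
qed

text \<open>A right-continuous process is the limit of its values at the next point of the grid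
  \<open>(k + 1) / n\<close>; the next point is strictly to the right, so only right limits matter.\<close>

lemma cadlag_jointly_measurable:
  fixes \<xi> :: "real \<Rightarrow> 'a \<Rightarrow> real"
  assumes meas: "\<And>t. 0 \<le> t \<Longrightarrow> \<xi> t \<in> borel_measurable N"
    and cadlag: "\<And>\<omega>. \<omega> \<in> space N \<Longrightarrow> cadlag (\<lambda>t. \<xi> t \<omega>)"
  shows "(\<lambda>(t, \<omega>). \<xi> (max 0 t) \<omega>) \<in> borel_measurable ((borel :: real measure) \<Otimes>\<^sub>M N)"
proof -
  define g where "g n t = (real_of_int \<lfloor>real (Suc n) * max 0 t\<rfloor> + 1) / real (Suc n)" for n and t :: real
  have "(\<lambda>z. \<xi> (max 0 (fst z)) (snd z)) \<in> borel_measurable ((borel :: real measure) \<Otimes>\<^sub>M N)"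
  proof (rule borel_measurable_LIMSEQ_real)
    fix n
    have meas': "(\<lambda>z. \<xi> (max 0 ((real_of_int k + 1) / real (Suc n))) (snd z)) \<in> borel_measurable ((borel :: real measure) \<Otimes>\<^sub>M N)" for k
      by (intro measurable_compose[OF measurable_snd meas]) simp
    \<comment> \<open>For a fixed value \<open>k\<close> of the floor the expression depends on the
      outcome alone and is measurable by assumption; the countably many values of \<open>k\<close>
      are glued.\<close>
    have "(\<lambda>z. (\<lambda>k z. \<xi> (max 0 ((real_of_int k + 1) / real (Suc n))) (snd z)) \<lfloor>real (Suc n) * max 0 (fst z)\<rfloor> z)
        \<in> borel_measurable ((borel :: real measure) \<Otimes>\<^sub>M N)"
      by (rule measurable_compose_countable[OF meas']) measurable
    then show "(\<lambda>z. \<xi> (max 0 (g n (fst z))) (snd z)) \<in> borel_measurable ((borel :: real measure) \<Otimes>\<^sub>M N)"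
      by (simp add: g_def)
  next
    fix z assume "z \<in> space ((borel :: real measure) \<Otimes>\<^sub>M N)"
    then have om: "snd z \<in> space N" by (auto simp: space_pair_measure)
    define t where "t = max 0 (fst z)"
    have t: "0 \<le> t" by (simp add: t_def)
    have g: "t < g n (fst z)" "g n (fst z) \<le> t + 1 / real (Suc n)" for n
    proof -
      have "real (Suc n) * t < real_of_int \<lfloor>real (Suc n) * t\<rfloor> + 1" by linarith
      then show "t < g n (fst z)" by (simp add: g_def t_def[symmetric] pos_less_divide_eq mult.commute)
      have "real_of_int \<lfloor>real (Suc n) * t\<rfloor> + 1 \<le> real (Suc n) * t + 1" by linarith
      then have "g n (fst z) \<le> (real (Suc n) * t + 1) / real (Suc n)"
        unfolding g_def t_def[symmetric] by (intro divide_right_mono) auto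
      then show "g n (fst z) \<le> t + 1 / real (Suc n)" by (simp add: add_divide_distrib)
    qed
    have "(\<lambda>n. g n (fst z)) \<longlonglongrightarrow> t"
    proof (rule tendsto_sandwich[of "\<lambda>_. t" _ _ "\<lambda>n. t + 1 / real (Suc n)"])
      have "(\<lambda>n. t + 1 / real (Suc n)) \<longlonglongrightarrow> t + 0"
        using tendsto_add[OF tendsto_const LIMSEQ_inverse_real_of_nat, of t] by (simp add: inverse_eq_divide)
      then show "(\<lambda>n. t + 1 / real (Suc n)) \<longlonglongrightarrow> t" by simp
    qed (use g in \<open>auto intro!: always_eventually less_imp_le\<close>)
    then have "filterlim (\<lambda>n. g n (fst z)) (at_right t) sequentially"
      using g(1) by (auto simp: filterlim_at intro!: always_eventually)
    moreover have "((\<lambda>s. \<xi> s (snd z)) \<longlongrightarrow> \<xi> t (snd z)) (at_right t)"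
      using cadlag[OF om] t by (simp add: cadlag_def continuous_within)
    ultimately have "(\<lambda>n. \<xi> (g n (fst z)) (snd z)) \<longlonglongrightarrow> \<xi> t (snd z)"
      by (rule filterlim_compose[rotated])
    moreover have "max 0 (g n (fst z)) = g n (fst z)" for n using g(1)[of n] t by simp
    ultimately show "(\<lambda>n. \<xi> (max 0 (g n (fst z))) (snd z)) \<longlonglongrightarrow> \<xi> (max 0 (fst z)) (snd z)"
      by (simp add: t_def)
  qed
  then show ?thesis by (simp add: case_prod_beta')
qed

section \<open>The risk model\<close>

lemma measurable_sub:
  assumes "f \<in> measurable N1 L" "sets N1 \<subseteq> sets N2" "space N1 = space N2"
  shows "f \<in> measurable N2 L"
  using assms by (auto simp: measurable_def)

text \<open>One horizon \<open>T\<close> is fixed, with a constant \<open>K\<close> for which the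
  lower bound on the returns holds along almost every path. \<open>0 \<le> K\<close> gives
  \<open>exp K \<ge> 1\<close>, as the Potter bound takes an argument of at least
  \<open>1\<close>.\<close>

locale risk_model = prob_space M
  for M :: "'a measure" +
  fixes X :: "nat \<Rightarrow> 'a \<Rightarrow> real ^ 'd"
    and \<theta> :: "nat \<Rightarrow> 'a \<Rightarrow> real"
    and \<xi> :: "real \<Rightarrow> 'a \<Rightarrow> real"
    and F :: "(real ^ 'd) measure"
    and A :: "(real ^ 'd) set"
    and T K :: real
  assumes A: "A \<in> class_R"
    and X_meas: "\<And>i. 1 \<le> i \<Longrightarrow> X i \<in> borel_measurable M"
    and X_distr: "\<And>i. 1 \<le> i \<Longrightarrow> distr M borel (X i) = F"
    and F_supp: "AE z in F. z \<in> quadrant"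
    and renewal: "renewal_interarrivals M \<theta>"
    and xi_meas: "\<And>t. 0 \<le> t \<Longrightarrow> \<xi> t \<in> borel_measurable M"
    and xi_cadlag: "\<And>\<omega>. \<omega> \<in> space M \<Longrightarrow> cadlag (\<lambda>t. \<xi> t \<omega>)"
    and indep: "independent_model M X \<theta> \<xi>"
    and xi_lower: "AE \<omega> in M. \<forall>t\<in>{0..T}. - K \<le> \<xi> t \<omega>"
    and K: "0 \<le> K"
    and F_C: "F \<in> class_C A"
    and horizon: "T \<in> finite_horizons M \<theta>"
begin

section \<open>The \<sigma>-algebras of claims, arrivals and returns\<close>

definition claim_space :: "'a measure" where
  "claim_space = process_space M borel {1..} X"

definition count_process_space :: "'a measure" where
  "count_process_space = process_space M (count_space UNIV) {0..} (claim_count \<theta>)"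

definition return_space :: "'a measure" where
  "return_space = process_space M borel {0..} \<xi>"

text \<open>The joint information of arrivals and returns: the proof conditions on it, and the
  claims are independent of it.\<close>

definition env_space :: "'a measure" where
  "env_space = sigma (space M) (sets count_process_space \<union> sets return_space)"

text \<open>A natural number is needed as the upper limit of sums; the value on the null event of
  infinitely many claims is arbitrary.\<close>

definition claim_number :: "'a \<Rightarrow> nat" where
  "claim_number \<omega> = the_enat (claim_count \<theta> T \<omega>)"

text \<open>The maximum with \<open>0\<close> changes nothing on the sample space, as arrivals are
  nonnegative there; it gives the form of the jointly measurable version of
  \<open>\<xi>\<close>.\<close>

definition weight :: "nat \<Rightarrow> 'a \<Rightarrow> real" where
  "weight i \<omega> = exp (- \<xi> (max 0 (arrival \<theta> i \<omega>)) \<omega>)"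

text \<open>The first argument drives the claims, the second one the arrivals and the returns.\<close>

definition aggregate :: "'a \<Rightarrow> 'a \<Rightarrow> real" where
  "aggregate \<omega>1 \<omega>2 = reduct A (\<Sum>i\<in>{1..claim_number \<omega>2}. weight i \<omega>2 *\<^sub>R X i \<omega>1)"

definition claim_tail :: "real \<Rightarrow> real" where
  "claim_tail x = measure F {z. x < reduct A z}"

lemma space_env [simp]: "space claim_space = space M" "space count_process_space = space M"
    "space return_space = space M" "space env_space = space M"
  using sets.space_closed[of count_process_space] sets.space_closed[of return_space]
  by (simp_all add: claim_space_def count_process_space_def return_space_def env_space_def space_measure_of)

lemma sets_env: "sets env_space = sigma_sets (space M) (sets count_process_space \<union> sets return_space)"
  using sets.space_closed[of count_process_space] sets.space_closed[of return_space]
  by (simp add: env_space_def sets_measure_of)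

lemma indep_claim_env: "indep_set (sets claim_space) (sets env_space)"
  and indep_return_count: "indep_set (sets return_space) (sets count_process_space)"
proof -
  define E where "E k = [process_events M borel {1..} X,
           process_events M (count_space UNIV) {0..} (claim_count \<theta>),
           process_events M borel {0..} \<xi>] ! k" for k
  have E: "E 0 = sets claim_space" "E 1 = sets count_process_space" "E 2 = sets return_space"
    by (simp_all add: E_def claim_space_def count_process_space_def return_space_def numeral_2_eq_2)
  have E': "E (Suc 0) = sets count_process_space" using E(2) by simp
  have ind: "indep_sets E {..<3}" using indep unfolding independent_model_def E_def .
  have lt3: "k \<in> {..<3} \<Longrightarrow> k = 0 \<or> k = 1 \<or> k = 2" for k :: nat by auto
  have st: "Int_stable (E k)" if "k \<in> {..<3}" for k
    using lt3[OF that] E sets.Int_stable by metis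
  have sig: "sigma_sets (space M) (sets N) = sets N" if "space N = space M" for N :: "'a measure"
    using sets.sigma_sets_eq[of N] that by simp
  show "indep_set (sets claim_space) (sets env_space)"
    using indep_set_sigma_Un[OF ind _ _ st, of "{0}" "{1, 2}"] by (simp add: E E' sig sets_env)
  show "indep_set (sets return_space) (sets count_process_space)"
    using indep_set_sigma_Un[OF ind _ _ st, of "{2}" "{1}"] by (simp add: E E' sig)
qed

lemma env_sub: "sets claim_space \<subseteq> events" "sets env_space \<subseteq> events"
    "sets count_process_space \<subseteq> sets env_space" "sets return_space \<subseteq> sets env_space"
  using indep_setD_ev1[OF indep_claim_env] indep_setD_ev2[OF indep_claim_env] by (auto simp: sets_env)

lemma measurable_env_M: "f \<in> measurable env_space L \<Longrightarrow> f \<in> measurable M L"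
  by (erule measurable_sub) (use env_sub in auto)

lemma claim_measurable: "1 \<le> i \<Longrightarrow> X i \<in> borel_measurable claim_space"
  unfolding claim_space_def by (rule measurable_process_space) auto

lemma count_measurable: "0 \<le> t \<Longrightarrow> claim_count \<theta> t \<in> measurable count_process_space (count_space UNIV)"
  unfolding count_process_space_def by (rule measurable_process_space) auto

lemma return_measurable: "0 \<le> t \<Longrightarrow> \<xi> t \<in> borel_measurable return_space"
  unfolding return_space_def by (rule measurable_process_space) auto

lemma T_nonneg: "0 \<le> T"
  using horizon by (simp add: finite_horizons_def)

lemma claim_number_measurable: "claim_number \<in> measurable env_space (count_space UNIV)"
proof -
  have "claim_number \<in> measurable count_process_space (count_space UNIV)"
    unfolding claim_number_def[abs_def] by (rule measurable_compose[OF count_measurable[OF T_nonneg]]) simp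
  then show ?thesis by (rule measurable_sub) (use env_sub in auto)
qed

text \<open>The independence assumption mentions the counts, not the arrivals. Arrival times are
  recovered from the counts, as at least \<open>i\<close> claims have occurred by time
  \<open>t\<close> exactly if the \<open>i\<close>-th arrival does not exceed
  \<open>t\<close>.\<close>

lemma arrival_count_measurable: "1 \<le> i \<Longrightarrow> arrival \<theta> i \<in> borel_measurable count_process_space"
proof (rule borel_measurableI_le)
  fix t assume i: "1 \<le> i"
  show "{\<omega> \<in> space count_process_space. arrival \<theta> i \<omega> \<le> t} \<in> sets count_process_space"
  proof (cases "0 \<le> t")
    case True
    have "{\<omega> \<in> space count_process_space. arrival \<theta> i \<omega> \<le> t} =
        claim_count \<theta> t -` {n. enat i \<le> n} \<inter> space count_process_space"
      using claim_count_ge_iff[OF renewal _ i] by auto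
    also have "\<dots> \<in> sets count_process_space"
      by (rule measurable_sets[OF count_measurable[OF True]]) simp
    finally show ?thesis .
  next
    case False
    then have "{\<omega> \<in> space count_process_space. arrival \<theta> i \<omega> \<le> t} = {}"
      using arrival_nonneg[OF renewal, of _ i] by force
    then show ?thesis by (simp only: sets.empty_sets)
  qed
qed

lemma arrival_env_measurable: "1 \<le> i \<Longrightarrow> arrival \<theta> i \<in> borel_measurable env_space"
  by (rule measurable_sub[OF arrival_count_measurable]) (use env_sub in auto)

lemma return_joint_measurable:
  "(\<lambda>(t, \<omega>). \<xi> (max 0 t) \<omega>) \<in> borel_measurable (borel \<Otimes>\<^sub>M return_space)"
  using return_measurable xi_cadlag by (intro cadlag_jointly_measurable) auto

lemma weight_measurable: "1 \<le> i \<Longrightarrow> weight i \<in> borel_measurable env_space"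
proof -
  assume i: "1 \<le> i"
  have "(\<lambda>\<omega>. \<omega>) \<in> measurable env_space return_space"
    by (rule measurable_sub[of _ return_space]) (use env_sub in auto)
  then have "(\<lambda>\<omega>. (arrival \<theta> i \<omega>, \<omega>)) \<in> measurable env_space (borel \<Otimes>\<^sub>M return_space)"
    by (intro measurable_Pair arrival_env_measurable[OF i])
  from measurable_compose[OF this return_joint_measurable]
  have "(\<lambda>\<omega>. \<xi> (max 0 (arrival \<theta> i \<omega>)) \<omega>) \<in> borel_measurable env_space" by simp
  then show ?thesis unfolding weight_def[abs_def] by measurable
qed

text \<open>Stated for arbitrary spaces because two choices are needed: the pair of independent
  \<sigma>-algebras, and two copies of \<open>M\<close>.\<close>

lemma aggregate_measurable:
  assumes "\<And>i. 1 \<le> i \<Longrightarrow> X i \<in> borel_measurable N1"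
    and "\<And>i. 1 \<le> i \<Longrightarrow> weight i \<in> borel_measurable N2"
    and "claim_number \<in> measurable N2 (count_space UNIV)"
  shows "(\<lambda>z. aggregate (fst z) (snd z)) \<in> borel_measurable (N1 \<Otimes>\<^sub>M N2)"
proof -
  have "(\<lambda>z. (\<lambda>n z. reduct A (\<Sum>i\<in>{1..n}. weight i (snd z) *\<^sub>R X i (fst z))) (claim_number (snd z)) z)
      \<in> borel_measurable (N1 \<Otimes>\<^sub>M N2)"
  proof (rule measurable_compose_countable)
    fix n
    have "(\<lambda>z. \<Sum>i\<in>{1..n}. weight i (snd z) *\<^sub>R X i (fst z)) \<in> borel_measurable (N1 \<Otimes>\<^sub>M N2)"
    proof (rule borel_measurable_sum)
      fix i assume "i \<in> {1..n}"
      then have "1 \<le> i" by simp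
      then show "(\<lambda>z. weight i (snd z) *\<^sub>R X i (fst z)) \<in> borel_measurable (N1 \<Otimes>\<^sub>M N2)"
        using measurable_compose[OF measurable_snd assms(2)] measurable_compose[OF measurable_fst assms(1)]
        by (intro borel_measurable_scaleR) auto
    qed
    then show "(\<lambda>z. reduct A (\<Sum>i\<in>{1..n}. weight i (snd z) *\<^sub>R X i (fst z))) \<in> borel_measurable (N1 \<Otimes>\<^sub>M N2)"
      by (rule measurable_compose[OF _ reduct_measurable[OF A]])
  qed (rule measurable_compose[OF measurable_snd assms(3)])
  then show ?thesis by (simp add: aggregate_def)
qed

section \<open>The common tail of the reduced claims\<close>

lemma sets_F: "sets F = sets borel"
  using X_distr[of 1] by (metis order_refl sets_distr)

lemma prob_space_F: "prob_space F"
  using prob_space_distr[OF X_meas[of 1]] X_distr[of 1] by simp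

lemma claim_tail_eq_prob:
  assumes "1 \<le> i"
  shows "prob {\<omega> \<in> space M. x < reduct A (X i \<omega>)} = claim_tail x"
proof -
  have "{z. x < reduct A z} \<in> sets borel"
    using measurable_sets_borel[OF reduct_measurable[OF A], of "{x<..}"] by (simp add: vimage_def)
  then have "measure (distr M borel (X i)) {z. x < reduct A z} = prob (X i -` {z. x < reduct A z} \<inter> space M)"
    using X_meas[OF assms] by (intro measure_distr) auto
  then have "claim_tail x = prob (X i -` {z. x < reduct A z} \<inter> space M)"
    by (simp add: claim_tail_def X_distr[OF assms])
  also have "X i -` {z. x < reduct A z} \<inter> space M = {\<omega> \<in> space M. x < reduct A (X i \<omega>)}" by auto
  finally show ?thesis by simp
qed

lemma claim_tail_eq_tail: "tail (distr F borel (reduct A)) x = claim_tail x"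
proof -
  interpret F: prob_space F by (rule prob_space_F)
  have m: "reduct A \<in> borel_measurable F"
    using reduct_measurable[OF A] sets_F by (simp cong: measurable_cong_sets)
  interpret R: prob_space "distr F borel (reduct A)" by (rule F.prob_space_distr[OF m])
  have "1 - cdf (distr F borel (reduct A)) x = measure (distr F borel (reduct A)) (space (distr F borel (reduct A)) - {..x})"
    unfolding cdf_def by (rule R.prob_compl[symmetric]) simp
  also have "space (distr F borel (reduct A)) - {..x} = {x<..}" by auto
  also have "measure (distr F borel (reduct A)) {x<..} = measure F (reduct A -` {x<..} \<inter> space F)"
    by (rule measure_distr[OF m]) simp
  also have "reduct A -` {x<..} \<inter> space F = {z. x < reduct A z}"
    using sets_eq_imp_space_eq[OF sets_F] by auto
  finally show ?thesis by (simp add: tail_def claim_tail_def)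
qed

lemma claim_tail_eq_tail_claim:
  assumes "1 \<le> i"
  shows "tail (distr M borel (\<lambda>\<omega>. reduct A (X i \<omega>))) x = claim_tail x"
proof -
  have "distr M borel (\<lambda>\<omega>. reduct A (X i \<omega>)) = distr F borel (reduct A)"
    using distr_distr[OF reduct_measurable[OF A] X_meas[OF assms]] X_distr[OF assms] by (simp add: comp_def)
  then show ?thesis by (simp add: claim_tail_eq_tail)
qed

lemma claim_tail_antimono: "x \<le> y \<Longrightarrow> claim_tail y \<le> claim_tail x"
proof -
  assume "x \<le> y"
  interpret F: prob_space F by (rule prob_space_F)
  have "{z. x < reduct A z} \<in> sets F"
    using measurable_sets_borel[OF reduct_measurable[OF A], of "{x<..}"] sets_F by (simp add: vimage_def)
  then show ?thesis unfolding claim_tail_def using \<open>x \<le> y\<close> by (intro F.finite_measure_mono) auto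
qed

lemma claim_tail_pos: "0 < claim_tail x"
proof -
  have "0 < claim_tail (max 0 x)"
    using F_C by (simp add: class_C_def consistently_varying_def halfline_distribution_def claim_tail_eq_tail)
  also have "\<dots> \<le> claim_tail x" by (rule claim_tail_antimono) simp
  finally show ?thesis .
qed

lemma claim_tail_le_1: "claim_tail x \<le> 1"
  unfolding claim_tail_def by (rule prob_space.prob_le_1[OF prob_space_F])

lemma claim_tail_potter: "\<exists>x0>0. \<exists>C>0. \<exists>q. \<forall>x\<ge>x0. \<forall>y\<ge>1. claim_tail (x / y) \<le> C * y ^ q * claim_tail x"
proof -
  have "((\<lambda>b. Limsup at_top (\<lambda>x. ereal (claim_tail (b * x) / claim_tail x))) \<longlongrightarrow> 1) (at_left 1)"
    using F_C by (simp add: class_C_def consistently_varying_def claim_tail_eq_tail)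
  \<comment> \<open>A limit of \<open>1\<close> puts the upper limit below \<open>2\<close> for some
    \<open>b < 1\<close>, which is the doubling condition of \<open>potter_bound\<close>.\<close>
  then have "\<forall>\<^sub>F b in at_left 1. Limsup at_top (\<lambda>x. ereal (claim_tail (b * x) / claim_tail x)) < 2"
    by (rule order_tendstoD(2)) simp
  moreover have "\<forall>\<^sub>F b in at_left (1::real). 0 < b \<and> b < 1"
    by (rule eventually_at_leftI[of 0]) auto
  ultimately have "\<exists>b. Limsup at_top (\<lambda>x. ereal (claim_tail (b * x) / claim_tail x)) < 2 \<and> 0 < b \<and> b < 1"
    using eventually_conj eventually_happens' trivial_limit_at_left_real by blast
  then obtain b where b: "Limsup at_top (\<lambda>x. ereal (claim_tail (b * x) / claim_tail x)) < 2" "0 < b" "b < 1" by blast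
  have "\<forall>\<^sub>F x in at_top. ereal (claim_tail (b * x) / claim_tail x) < 2" by (rule Limsup_lessD[OF b(1)])
  then obtain x1 where x1: "\<And>x. x1 \<le> x \<Longrightarrow> ereal (claim_tail (b * x) / claim_tail x) < 2"
    by (auto simp: eventually_at_top_linorder)
  have "claim_tail (b * x) \<le> 2 * claim_tail x" if "max 1 x1 \<le> x" for x
  proof -
    have "ereal (claim_tail (b * x) / claim_tail x) < ereal 2" using x1[of x] that by simp
    then show ?thesis using claim_tail_pos[of x] by (simp add: field_simps)
  qed
  with potter_bound[of claim_tail b "max 1 x1"] claim_tail_antimono claim_tail_pos claim_tail_le_1 b
  show ?thesis by (intro exI[of _ "max 1 x1"]) auto
qed

lemma le_claim_number_iff:
  assumes "\<omega> \<in> space M" "claim_count \<theta> T \<omega> \<noteq> \<infinity>" "1 \<le> i"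
  shows "i \<le> claim_number \<omega> \<longleftrightarrow> arrival \<theta> i \<omega> \<le> T"
proof -
  have "enat (claim_number \<omega>) = claim_count \<theta> T \<omega>" using assms(2) by (auto simp: claim_number_def)
  then show ?thesis using claim_count_ge_iff[OF renewal assms(1,3), of T] by (metis enat_ord_simps(1))
qed

lemma weight_pos: "0 < weight i \<omega>"
  by (simp add: weight_def)

text \<open>Indices up to \<open>claim_number\<close> belong to arrivals in \<open>[0, T]\<close>,
  the range in which the lower bound on the returns holds.\<close>

lemma weight_le_AE: "AE \<omega> in M. \<forall>i\<in>{1..claim_number \<omega>}. weight i \<omega> \<le> exp K"
  using xi_lower claim_count_finite_AE[OF renewal, of T] AE_space
proof eventually_elim
  case (elim \<omega>)
  have "- K \<le> \<xi> (max 0 (arrival \<theta> i \<omega>)) \<omega>" if "i \<in> {1..claim_number \<omega>}" for i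
    using elim(1) le_claim_number_iff[OF elim(3,2), of i] that arrival_nonneg[OF renewal elim(3), of i] by auto
  then show ?case by (auto simp: weight_def minus_le_iff)
qed

section \<open>Conditioning on arrivals and returns\<close>

definition cond_tail :: "real \<Rightarrow> 'a \<Rightarrow> real" where
  "cond_tail x \<omega>2 = prob {\<omega>1 \<in> space M. x < aggregate \<omega>1 \<omega>2}"

lemma cond_tail_nonneg: "0 \<le> cond_tail x \<omega>"
  by (simp add: cond_tail_def)

lemma aggregate_section_measurable: "(\<lambda>\<omega>1. aggregate \<omega>1 \<omega>2) \<in> borel_measurable M"
proof -
  have "(\<lambda>\<omega>1. \<Sum>i\<in>{1..claim_number \<omega>2}. weight i \<omega>2 *\<^sub>R X i \<omega>1) \<in> borel_measurable M"
    using X_meas by (intro borel_measurable_sum borel_measurable_scaleR) auto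
  then show ?thesis unfolding aggregate_def by (rule measurable_compose[OF _ reduct_measurable[OF A]])
qed

lemma emeasure_section:
  "(\<integral>\<^sup>+\<omega>1. indicator {x<..} (aggregate \<omega>1 \<omega>2) \<partial>M) = ennreal (cond_tail x \<omega>2)"
proof -
  note [measurable] = aggregate_section_measurable
  have "(\<integral>\<^sup>+\<omega>1. indicator {x<..} (aggregate \<omega>1 \<omega>2) \<partial>M) = (\<integral>\<^sup>+\<omega>1. indicator {\<omega>1 \<in> space M. x < aggregate \<omega>1 \<omega>2} \<omega>1 \<partial>M)"
    by (intro nn_integral_cong) (auto simp: indicator_def)
  also have "\<dots> = emeasure M {\<omega>1 \<in> space M. x < aggregate \<omega>1 \<omega>2}" by (rule nn_integral_indicator) measurable
  finally show ?thesis by (simp add: cond_tail_def emeasure_eq_measure)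
qed

lemma cond_tail_measurable: "cond_tail x \<in> borel_measurable M"
proof -
  have aggregate: "(\<lambda>z. aggregate (fst z) (snd z)) \<in> borel_measurable (M \<Otimes>\<^sub>M M)"
    using X_meas measurable_env_M[OF weight_measurable] measurable_env_M[OF claim_number_measurable] by (intro aggregate_measurable)
  have "(\<lambda>z. aggregate (fst ((\<lambda>(x, y). (y, x)) z)) (snd ((\<lambda>(x, y). (y, x)) z))) \<in> borel_measurable (M \<Otimes>\<^sub>M M)"
    by (rule measurable_compose[OF measurable_pair_swap' aggregate])
  then have [measurable]: "(\<lambda>(\<omega>2, \<omega>1). aggregate \<omega>1 \<omega>2) \<in> borel_measurable (M \<Otimes>\<^sub>M M)"
    by (simp add: case_prod_beta')
  have "(\<lambda>(\<omega>2, \<omega>1). indicator {x<..} (aggregate \<omega>1 \<omega>2) :: ennreal) \<in> borel_measurable (M \<Otimes>\<^sub>M M)" by measurable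
  then have "(\<lambda>\<omega>2. \<integral>\<^sup>+\<omega>1. indicator {x<..} (aggregate \<omega>1 \<omega>2) \<partial>M) \<in> borel_measurable M"
    by (rule borel_measurable_nn_integral)
  then have "(\<lambda>\<omega>2. enn2real (ennreal (cond_tail x \<omega>2))) \<in> borel_measurable M"
    unfolding emeasure_section by (rule measurable_compose) measurable
  then show ?thesis by (simp add: cond_tail_nonneg)
qed

text \<open>On the diagonal, \<open>aggregate \<omega> \<omega>\<close> is almost surely the reduct
  of the discounted claims. Independence of claims and environment lets the two arguments be
  integrated separately, and the inner integral is \<open>cond_tail\<close>.\<close>

lemma prob_discounted_claims:
  assumes x: "0 < x"
  shows "prob {\<omega> \<in> space M. discounted_claims X \<theta> \<xi> T \<omega> \<in> (\<lambda>a. x *\<^sub>R a) ` A} = expectation (cond_tail x)"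
proof -
  have aggregate: "(\<lambda>z. aggregate (fst z) (snd z)) \<in> borel_measurable (claim_space \<Otimes>\<^sub>M env_space)"
    using claim_measurable weight_measurable claim_number_measurable by (intro aggregate_measurable)
  have "(\<lambda>z. aggregate (fst z) (snd z)) \<in> borel_measurable (M \<Otimes>\<^sub>M M)"
    using X_meas measurable_env_M[OF weight_measurable] measurable_env_M[OF claim_number_measurable] by (intro aggregate_measurable)
  from measurable_compose[OF _ this, of "\<lambda>\<omega>. (\<omega>, \<omega>)"]
  have diag [measurable]: "(\<lambda>\<omega>. aggregate \<omega> \<omega>) \<in> borel_measurable M" by simp
  have disc: "discounted_claims X \<theta> \<xi> T \<omega> \<in> (\<lambda>a. x *\<^sub>R a) ` A \<longleftrightarrow> claim_count \<theta> T \<omega> \<noteq> \<infinity> \<and> x < aggregate \<omega> \<omega>"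
    if om: "\<omega> \<in> space M" for \<omega>
  proof (cases "claim_count \<theta> T \<omega> = \<infinity>")
    case True
    \<comment> \<open>A sum over an infinite index set is \<open>0\<close> by convention, and
      \<open>0\<close> lies in no dilate of \<open>A\<close> by a positive factor; these outcomes
      are thus outside the event.\<close>
    have "infinite {i::nat. 1 \<le> i}" using infinite_Ici[of "1::nat"] by (simp add: atLeast_def)
    then have "discounted_claims X \<theta> \<xi> T \<omega> = 0" using True by (simp add: discounted_claims_def)
    then show ?thesis using True mem_dilation_iff_less_reduct[OF A x, of 0] reduct_zero[OF A] x by simp
  next
    case False
    then have "{i. 1 \<le> i \<and> enat i \<le> claim_count \<theta> T \<omega>} = {1..claim_number \<omega>}" by (auto simp: claim_number_def)
    moreover have "max 0 (arrival \<theta> i \<omega>) = arrival \<theta> i \<omega>" for i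
      using arrival_nonneg[OF renewal om, of i] by simp
    ultimately have "reduct A (discounted_claims X \<theta> \<xi> T \<omega>) = aggregate \<omega> \<omega>"
      by (simp add: discounted_claims_def aggregate_def weight_def)
    then show ?thesis using False mem_dilation_iff_less_reduct[OF A x] by simp
  qed
  have fin: "AE \<omega> in M. claim_count \<theta> T \<omega> \<noteq> \<infinity>" by (rule claim_count_finite_AE[OF renewal])
  have cc: "claim_count \<theta> T \<in> measurable M (count_space UNIV)"
    by (rule measurable_sub[OF count_measurable[OF T_nonneg]]) (use env_sub in auto)
  have "prob {\<omega> \<in> space M. discounted_claims X \<theta> \<xi> T \<omega> \<in> (\<lambda>a. x *\<^sub>R a) ` A}
      = prob {\<omega> \<in> space M. claim_count \<theta> T \<omega> \<noteq> \<infinity> \<and> x < aggregate \<omega> \<omega>}"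
    by (rule arg_cong[of _ _ prob]) (use disc in blast)
  also have "\<dots> = prob {\<omega> \<in> space M. x < aggregate \<omega> \<omega>}"
  proof (rule measure_eq_AE)
    show "{\<omega> \<in> space M. claim_count \<theta> T \<omega> \<noteq> \<infinity> \<and> x < aggregate \<omega> \<omega>} \<in> events"
    proof -
      have "{\<omega> \<in> space M. claim_count \<theta> T \<omega> \<noteq> \<infinity> \<and> x < aggregate \<omega> \<omega>} =
          (claim_count \<theta> T -` (- {\<infinity>}) \<inter> space M) \<inter> {\<omega> \<in> space M. x < aggregate \<omega> \<omega>}" by auto
      also have "\<dots> \<in> events" by (intro sets.Int measurable_sets[OF cc]) auto
      finally show ?thesis .
    qed
  qed (use fin in \<open>auto elim: eventually_mono\<close>)
  finally have eq: "prob {\<omega> \<in> space M. discounted_claims X \<theta> \<xi> T \<omega> \<in> (\<lambda>a. x *\<^sub>R a) ` A}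
      = prob {\<omega> \<in> space M. x < aggregate \<omega> \<omega>}" .
  have "ennreal (prob {\<omega> \<in> space M. x < aggregate \<omega> \<omega>}) = (\<integral>\<^sup>+\<omega>. indicator {\<omega> \<in> space M. x < aggregate \<omega> \<omega>} \<omega> \<partial>M)"
    by (simp add: emeasure_eq_measure)
  also have "\<dots> = (\<integral>\<^sup>+\<omega>. indicator {x<..} (aggregate (fst (\<omega>, \<omega>)) (snd (\<omega>, \<omega>))) \<partial>M)"
    by (intro nn_integral_cong) (auto simp: indicator_def)
  also have "\<dots> = (\<integral>\<^sup>+\<omega>2. (\<integral>\<^sup>+\<omega>1. indicator {x<..} (aggregate (fst (\<omega>1, \<omega>2)) (snd (\<omega>1, \<omega>2))) \<partial>M) \<partial>M)"
    using aggregate by (intro indep_set_nn_integral[OF indep_claim_env, where f = "\<lambda>z. indicator {x<..} (aggregate (fst z) (snd z))"]) auto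
  also have "\<dots> = (\<integral>\<^sup>+\<omega>2. ennreal (cond_tail x \<omega>2) \<partial>M)" by (simp add: emeasure_section)
  finally have "prob {\<omega> \<in> space M. x < aggregate \<omega> \<omega>} = enn2real (\<integral>\<^sup>+\<omega>2. ennreal (cond_tail x \<omega>2) \<partial>M)"
    by (metis enn2real_ennreal measure_nonneg)
  also have "\<dots> = expectation (cond_tail x)"
    by (rule integral_eq_nn_integral[symmetric]) (auto simp: cond_tail_measurable cond_tail_nonneg)
  finally show ?thesis using eq by simp
qed

text \<open>If \<open>N\<close> claims with discount factors at most \<open>exp K\<close> together
  exceed \<open>x\<close>, some reduct exceeds \<open>x / (N * exp K)\<close>. A union bound and the
  Potter bound at \<open>y = N * exp K\<close> leave the power \<open>N ^ Suc q\<close>: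
  \<open>q\<close> factors from Potter and one from the union.\<close>

lemma cond_tail_bound:
  "\<exists>x0>0. \<exists>g. integrable M g \<and> (\<forall>x\<ge>x0. AE \<omega> in M. cond_tail x \<omega> \<le> g \<omega> * claim_tail x)"
proof -
  obtain x0 C q where x0: "0 < x0" and C: "0 < C"
    and potter: "\<And>x y. x0 \<le> x \<Longrightarrow> 1 \<le> y \<Longrightarrow> claim_tail (x / y) \<le> C * y ^ q * claim_tail x"
    using claim_tail_potter by blast
  define g where "g \<omega> = C * exp K ^ q * real (claim_number \<omega>) ^ Suc q" for \<omega>
  have "integrable M g"
    unfolding g_def claim_number_def
    by (intro integrable_mult_right claim_count_moment renewal measurable_env_M[OF claim_number_measurable, unfolded claim_number_def[abs_def]])
  moreover have "AE \<omega> in M. cond_tail x \<omega> \<le> g \<omega> * claim_tail x" if x: "x0 \<le> x" for x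
    using weight_le_AE
  proof eventually_elim
    case (elim \<omega>)
    define y where "y = real (claim_number \<omega>) * exp K"
    have sum_ge: "\<exists>i\<in>{1..claim_number \<omega>}. x / y < reduct A (X i \<omega>1)" if gt: "x < aggregate \<omega>1 \<omega>" for \<omega>1
    proof (rule ccontr)
      assume n: "\<not> ?thesis"
      have "aggregate \<omega>1 \<omega> \<le> (\<Sum>i\<in>{1..claim_number \<omega>}. weight i \<omega> * reduct A (X i \<omega>1))"
        unfolding aggregate_def using reduct_sum_le[OF A, of "\<lambda>i. weight i \<omega> *\<^sub>R X i \<omega>1" "{1..claim_number \<omega>}"]
        by (simp add: reduct_scaleR[OF A weight_pos])
      also have "\<dots> \<le> (\<Sum>i\<in>{1..claim_number \<omega>}. exp K * (x / y))"
        using elim n reduct_nonneg[OF A] by (intro sum_mono mult_mono) (auto simp: not_less)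
      also have "\<dots> \<le> x" using x x0 by (auto simp: y_def)
      finally show False using gt by simp
    qed
    show ?case
    proof (cases "claim_number \<omega> = 0")
      case True
      then have "{\<omega>1 \<in> space M. x < aggregate \<omega>1 \<omega>} = {}" using sum_ge by auto
      then have "cond_tail x \<omega> = 0" by (simp only: cond_tail_def measure_empty)
      then show ?thesis using C claim_tail_pos[of x] by (simp add: g_def)
    next
      case False
      have y: "1 \<le> y" using False K mult_mono[of 1 "real (claim_number \<omega>)" 1 "exp K"] by (simp add: y_def)
      have ev: "{\<omega>1 \<in> space M. x / y < reduct A (X i \<omega>1)} \<in> events" if "1 \<le> i" for i
      proof -
        have [measurable]: "(\<lambda>\<omega>1. reduct A (X i \<omega>1)) \<in> borel_measurable M"
          by (rule measurable_compose[OF X_meas[OF that] reduct_measurable[OF A]])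
        show ?thesis by measurable
      qed
      have "cond_tail x \<omega> \<le> prob (\<Union>i\<in>{1..claim_number \<omega>}. {\<omega>1 \<in> space M. x / y < reduct A (X i \<omega>1)})"
        unfolding cond_tail_def using sum_ge ev by (intro finite_measure_mono sets.finite_UN) auto
      also have "\<dots> \<le> (\<Sum>i\<in>{1..claim_number \<omega>}. prob {\<omega>1 \<in> space M. x / y < reduct A (X i \<omega>1)})"
        using ev by (intro finite_measure_subadditive_finite) auto
      also have "\<dots> = real (claim_number \<omega>) * claim_tail (x / y)" using claim_tail_eq_prob by simp
      also have "\<dots> \<le> real (claim_number \<omega>) * (C * y ^ q * claim_tail x)" using potter[OF x y] by (intro mult_left_mono) auto
      also have "\<dots> = g \<omega> * claim_tail x" by (simp add: g_def y_def power_mult_distrib)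
      finally show ?thesis .
    qed
  qed
  ultimately show ?thesis using x0 by blast
qed

lemma prob_discounted_claims_bound:
  "\<exists>x0>0. \<exists>B. \<forall>x\<ge>x0. prob {\<omega> \<in> space M. discounted_claims X \<theta> \<xi> T \<omega> \<in> (\<lambda>a. x *\<^sub>R a) ` A} \<le> B * claim_tail x"
proof -
  obtain x0 g where x0: "0 < x0" and g: "integrable M g" "\<And>x. x0 \<le> x \<Longrightarrow> AE \<omega> in M. cond_tail x \<omega> \<le> g \<omega> * claim_tail x"
    using cond_tail_bound by blast
  have "prob {\<omega> \<in> space M. discounted_claims X \<theta> \<xi> T \<omega> \<in> (\<lambda>a. x *\<^sub>R a) ` A} \<le> expectation g * claim_tail x"
    if x: "x0 \<le> x" for x
  proof -
    have "integrable M (cond_tail x)"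
      using cond_tail_measurable by (intro integrable_const_bound[of _ 1]) (auto simp: cond_tail_def)
    then have "expectation (cond_tail x) \<le> expectation (\<lambda>\<omega>. g \<omega> * claim_tail x)"
      using g(1) g(2)[OF x] by (intro integral_mono_AE integrable_mult_left) auto
    then show ?thesis using prob_discounted_claims[of x] x x0 by simp
  qed
  then show ?thesis using x0 by blast
qed

text \<open>The integral of \<open>exp (- \<alpha> * \<xi>)\<close> against the claim arrivals in
  \<open>[0, T]\<close>, path by path; its expectation is the renewal integral.\<close>

definition weight_sum :: "real \<Rightarrow> 'a \<Rightarrow> real" where
  "weight_sum \<alpha> \<omega> = (\<Sum>i\<in>{1..claim_number \<omega>}. weight i \<omega> powr \<alpha>)"

lemma cond_tail_limit:
  assumes rv: "\<And>y. 0 < y \<Longrightarrow> ((\<lambda>x. claim_tail (y * x) / claim_tail x) \<longlongrightarrow> y powr (-\<alpha>)) at_top"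
    and qai: "QAI_on A M X"
  shows "((\<lambda>x. cond_tail x \<omega>2 / claim_tail x) \<longlongrightarrow> weight_sum \<alpha> \<omega>2) at_top"
  unfolding cond_tail_def weight_sum_def
proof (rule weighted_max_sum_tail[where Z = "\<lambda>i \<omega>. reduct A (X i \<omega>)"])
  show "(\<lambda>\<omega>. reduct A (X i \<omega>)) \<in> borel_measurable M" if "i \<in> {1..claim_number \<omega>2}" for i
    using that by (intro measurable_compose[OF X_meas reduct_measurable[OF A]]) auto
  show "prob {\<omega> \<in> space M. x < reduct A (X i \<omega>)} = claim_tail x" if "i \<in> {1..claim_number \<omega>2}" for i x
    using that by (intro claim_tail_eq_prob) auto
  show "((\<lambda>x. prob {\<omega> \<in> space M. x < reduct A (X i \<omega>) \<and> x < reduct A (X j \<omega>)} / claim_tail x) \<longlongrightarrow> 0) at_top"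
    if ij: "i \<in> {1..claim_number \<omega>2}" "j \<in> {1..claim_number \<omega>2}" "i \<noteq> j" for i j
  proof -
    \<comment> \<open>With identically distributed claims the two tails in the denominator coincide;
      the resulting factor \<open>2\<close> is removed below.\<close>
    have "((\<lambda>x. prob {\<omega> \<in> space M. x < reduct A (X i \<omega>) \<and> x < reduct A (X j \<omega>)} / (claim_tail x + claim_tail x)) \<longlongrightarrow> 0) at_top"
      using qai ij by (auto simp: QAI_on_def QAI_def claim_tail_eq_tail_claim)
    from tendsto_mult[OF tendsto_const[of 2] this] show ?thesis by simp
  qed
  show "AE \<omega> in M. aggregate \<omega> \<omega>2 \<le> (\<Sum>i\<in>{1..claim_number \<omega>2}. weight i \<omega>2 * reduct A (X i \<omega>))"
    using reduct_sum_le[OF A, of "\<lambda>i. weight i \<omega>2 *\<^sub>R X i _" "{1..claim_number \<omega>2}"]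
    by (simp add: aggregate_def reduct_scaleR[OF A weight_pos])
  have "AE \<omega> in M. X i \<omega> \<in> quadrant" if "1 \<le> i" for i
  proof (rule AE_distrD[OF X_meas[OF that]])
    show "AE z in distr M borel (X i). z \<in> quadrant" unfolding X_distr[OF that] by (rule F_supp)
  qed
  then have "AE \<omega> in M. \<forall>i\<in>{1..claim_number \<omega>2}. X i \<omega> \<in> quadrant"
    by (intro AE_finite_allI) auto
  then show "AE \<omega> in M. \<forall>i\<in>{1..claim_number \<omega>2}. weight i \<omega>2 * reduct A (X i \<omega>) \<le> aggregate \<omega> \<omega>2"
  proof eventually_elim
    case (elim \<omega>)
    show ?case
    proof
      fix i assume i: "i \<in> {1..claim_number \<omega>2}"
      have "reduct A (weight i \<omega>2 *\<^sub>R X i \<omega>) \<le> reduct A (\<Sum>j\<in>{1..claim_number \<omega>2}. weight j \<omega>2 *\<^sub>R X j \<omega>)"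
        using elim i by (intro reduct_le_sum[OF A, of _ _ "\<lambda>i. weight i \<omega>2 *\<^sub>R X i \<omega>"] quadrant_scaleR less_imp_le[OF weight_pos]) auto
      then show "weight i \<omega>2 * reduct A (X i \<omega>) \<le> aggregate \<omega> \<omega>2"
        by (simp add: aggregate_def reduct_scaleR[OF A weight_pos])
    qed
  qed
qed (use claim_tail_pos rv weight_pos aggregate_section_measurable in auto)

lemma weight_sum_measurable: "weight_sum \<alpha> \<in> borel_measurable M"
proof -
  have "(\<lambda>\<omega>. (\<lambda>n \<omega>. \<Sum>i\<in>{1..n}. weight i \<omega> powr \<alpha>) (claim_number \<omega>) \<omega>) \<in> borel_measurable M"
  proof (rule measurable_compose_countable[OF _ measurable_env_M[OF claim_number_measurable]])
    fix n
    show "(\<lambda>\<omega>. \<Sum>i\<in>{1..n}. weight i \<omega> powr \<alpha>) \<in> borel_measurable M"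
    proof (rule borel_measurable_sum)
      fix i assume "i \<in> {1..n}"
      then have [measurable]: "weight i \<in> borel_measurable M" by (intro measurable_env_M[OF weight_measurable]) auto
      show "(\<lambda>\<omega>. weight i \<omega> powr \<alpha>) \<in> borel_measurable M" by measurable
    qed
  qed
  then show ?thesis by (simp add: weight_sum_def[abs_def])
qed

lemma prob_discounted_claims_limit:
  assumes rv: "\<And>y. 0 < y \<Longrightarrow> ((\<lambda>x. claim_tail (y * x) / claim_tail x) \<longlongrightarrow> y powr (-\<alpha>)) at_top"
    and qai: "QAI_on A M X"
  shows "((\<lambda>x. prob {\<omega> \<in> space M. discounted_claims X \<theta> \<xi> T \<omega> \<in> (\<lambda>a. x *\<^sub>R a) ` A} / claim_tail x)
    \<longlongrightarrow> expectation (weight_sum \<alpha>)) at_top"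
proof -
  obtain x0 g where x0: "0 < x0" and g: "integrable M g" "\<And>x. x0 \<le> x \<Longrightarrow> AE \<omega> in M. cond_tail x \<omega> \<le> g \<omega> * claim_tail x"
    using cond_tail_bound by blast
  have "((\<lambda>x. expectation (\<lambda>\<omega>. cond_tail x \<omega> / claim_tail x)) \<longlongrightarrow> expectation (weight_sum \<alpha>)) at_top"
  proof (rule integral_dominated_convergence_at_top[where w = g])
    show "\<forall>\<^sub>F x in at_top. AE \<omega> in M. norm (cond_tail x \<omega> / claim_tail x) \<le> g \<omega>"
      using eventually_ge_at_top[of x0]
    proof eventually_elim
      case (elim x)
      from g(2)[OF elim] show ?case
        by eventually_elim (use claim_tail_pos[of x] cond_tail_nonneg in \<open>simp add: pos_divide_le_eq\<close>)
    qed
  qed (use cond_tail_limit[OF rv qai] g(1) cond_tail_measurable weight_sum_measurable in auto)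
  moreover have "\<forall>\<^sub>F x in at_top. expectation (\<lambda>\<omega>. cond_tail x \<omega> / claim_tail x) =
      prob {\<omega> \<in> space M. discounted_claims X \<theta> \<xi> T \<omega> \<in> (\<lambda>a. x *\<^sub>R a) ` A} / claim_tail x"
    using eventually_gt_at_top[of 0] by eventually_elim (simp add: prob_discounted_claims)
  ultimately show ?thesis by (rule Lim_transform_eventually)
qed

lemma weight_sum_integrable:
  assumes "0 < \<alpha>"
  shows "integrable M (weight_sum \<alpha>)"
proof (rule Bochner_Integration.integrable_bound)
  show "integrable M (\<lambda>\<omega>. exp K powr \<alpha> * real (claim_number \<omega>) ^ Suc 0)"
    unfolding claim_number_def
    by (intro integrable_mult_right claim_count_moment renewal measurable_env_M[OF claim_number_measurable, unfolded claim_number_def[abs_def]])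
  show "AE \<omega> in M. norm (weight_sum \<alpha> \<omega>) \<le> norm (exp K powr \<alpha> * real (claim_number \<omega>) ^ Suc 0)"
    using weight_le_AE
  proof eventually_elim
    case (elim \<omega>)
    have "weight_sum \<alpha> \<omega> \<le> (\<Sum>i\<in>{1..claim_number \<omega>}. exp K powr \<alpha>)"
      unfolding weight_sum_def using elim assms less_imp_le[OF weight_pos] by (intro sum_mono powr_mono2) auto
    moreover have "0 \<le> weight_sum \<alpha> \<omega>" unfolding weight_sum_def by (intro sum_nonneg) auto
    ultimately show ?case by (simp add: mult.commute)
  qed
qed (rule weight_sum_measurable)

text \<open>Positivity of the renewal function at \<open>T\<close> enters here: a vanishing
  expectation would leave no claims by time \<open>T\<close> almost surely. The result allows
  division by the limit constant.\<close>

lemma weight_sum_pos: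
  assumes "0 < \<alpha>"
  shows "0 < expectation (weight_sum \<alpha>)"
proof (rule ccontr)
  have nn: "0 \<le> weight_sum \<alpha> \<omega>" for \<omega> unfolding weight_sum_def by (intro sum_nonneg) auto
  assume "\<not> ?thesis"
  moreover have "0 \<le> expectation (weight_sum \<alpha>)" using nn by (intro integral_nonneg_AE) auto
  ultimately have "expectation (weight_sum \<alpha>) = 0" by simp
  then have "AE \<omega> in M. weight_sum \<alpha> \<omega> = 0"
    using integral_nonneg_eq_0_iff_AE[OF weight_sum_integrable[OF assms]] nn by simp
  then have "AE \<omega> in M. claim_count \<theta> T \<omega> = 0"
    using claim_count_finite_AE[OF renewal, of T]
  proof eventually_elim
    case (elim \<omega>)
    then have "\<forall>i\<in>{1..claim_number \<omega>}. weight i \<omega> powr \<alpha> = 0"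
      unfolding weight_sum_def by (subst (asm) sum_nonneg_eq_0_iff) auto
    then have "claim_number \<omega> = 0" using weight_pos[of 1 \<omega>] by (cases "claim_number \<omega>") force+
    then show ?case using elim(2) by (auto simp: claim_number_def zero_enat_def)
  qed
  then have "renewal_fun M \<theta> T = (\<integral>\<^sup>+\<omega>. 0 \<partial>M)"
    unfolding renewal_fun_def by (intro nn_integral_cong_AE) (auto elim: eventually_mono)
  then show False using horizon by (simp add: finite_horizons_def)
qed

section \<open>The renewal integral as an expectation\<close>

lemma exp_returns_nn_integral:
  assumes \<alpha>: "0 < \<alpha>" and s: "s \<in> {0..T}"
  shows "(\<integral>\<^sup>+\<omega>. ennreal (exp (- \<alpha> * \<xi> (max 0 s) \<omega>)) \<partial>M) = ennreal (LINT \<omega>|M. exp (- \<alpha> * \<xi> s \<omega>))"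
proof -
  have [measurable]: "\<xi> s \<in> borel_measurable M" using s xi_meas by simp
  have "AE \<omega> in M. norm (exp (- \<alpha> * \<xi> s \<omega>)) \<le> exp (\<alpha> * K)"
    using xi_lower
  proof eventually_elim
    case (elim \<omega>)
    then have "- K \<le> \<xi> s \<omega>" using s by blast
    then have "\<alpha> * (- \<xi> s \<omega>) \<le> \<alpha> * K" using \<alpha> by (intro mult_left_mono) linarith+
    then show ?case by simp
  qed
  then have "integrable M (\<lambda>\<omega>. exp (- \<alpha> * \<xi> s \<omega>))"
    by (intro integrable_const_bound[of _ "exp (\<alpha> * K)"]) auto
  moreover have "max 0 s = s" using s by simp
  ultimately show ?thesis by (simp add: nn_integral_eq_integral)
qed

text \<open>Campbell's formula evaluates the expectation of
  \<open>exp (- \<alpha> * \<xi> s)\<close> at the arrival times. Since returns and arrivals are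
  independent, the inner expectation over a separate outcome may be put on the diagonal, which turns
  each term into the expectation of \<open>weight (Suc i) powr \<alpha>\<close> on the event of
  arrival by \<open>T\<close>.\<close>

lemma renewal_integral:
  assumes \<alpha>: "0 < \<alpha>"
  shows "(LINT s:{0..T}|renewal_measure M \<theta>. (LINT \<omega>|M. exp (- \<alpha> * \<xi> s \<omega>))) = expectation (weight_sum \<alpha>)"
proof -
  define \<phi> where "\<phi> s = (\<integral>\<^sup>+\<omega>. ennreal (exp (- \<alpha> * \<xi> (max 0 s) \<omega>)) \<partial>M)" for s
  define \<psi> where "\<psi> s = (LINT \<omega>|M. exp (- \<alpha> * \<xi> s \<omega>))" for s
  have \<phi>\<psi>: "\<phi> s = ennreal (\<psi> s)" if "s \<in> {0..T}" for s
    unfolding \<phi>_def \<psi>_def by (rule exp_returns_nn_integral[OF \<alpha> that])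
  have \<psi>0: "0 \<le> \<psi> s" for s unfolding \<psi>_def by (rule integral_nonneg_AE) auto
  have [measurable]: "(\<lambda>(t, \<omega>). \<xi> (max 0 t) \<omega>) \<in> borel_measurable (borel \<Otimes>\<^sub>M M)"
    using xi_meas xi_cadlag by (intro cadlag_jointly_measurable) auto
  have "(\<lambda>(t, \<omega>). ennreal (exp (- \<alpha> * \<xi> (max 0 t) \<omega>))) \<in> borel_measurable (borel \<Otimes>\<^sub>M M)" by measurable
  then have \<phi>m [measurable]: "\<phi> \<in> borel_measurable borel"
    unfolding \<phi>_def[abs_def] by (rule borel_measurable_nn_integral)
  \<comment> \<open>The assumptions on \<open>\<xi>\<close> concern nonnegative times. Measurability
    in \<open>s\<close> on the whole line is known for \<open>\<phi>\<close>, and the indicator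
    makes the two functions agree.\<close>
  have ind\<psi>: "indicator {0..T} s * \<psi> s = indicator {0..T} s * enn2real (\<phi> s)" for s
    using \<phi>\<psi>[of s] \<psi>0[of s] by (auto simp: indicator_def)
  have "(LINT s:{0..T}|renewal_measure M \<theta>. \<psi> s)
      = enn2real (\<integral>\<^sup>+s. ennreal (indicator {0..T} s * \<psi> s) \<partial>renewal_measure M \<theta>)"
    unfolding set_lebesgue_integral_def real_scaleR_def
  proof (rule integral_eq_nn_integral)
    show "(\<lambda>s. indicator {0..T} s * \<psi> s) \<in> borel_measurable (renewal_measure M \<theta>)"
      unfolding ind\<psi> measurable_cong_sets[OF sets_renewal_measure refl] by measurable
  qed (use \<psi>0 in auto)
  also have "(\<integral>\<^sup>+s. ennreal (indicator {0..T} s * \<psi> s) \<partial>renewal_measure M \<theta>)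
      = (\<integral>\<^sup>+s. indicator {0..T} s * \<phi> s \<partial>renewal_measure M \<theta>)"
    by (intro nn_integral_cong) (auto simp: indicator_def \<phi>\<psi>)
  also have "\<dots> = (\<Sum>i. \<integral>\<^sup>+\<omega>. indicator {0..T} (arrival \<theta> (Suc i) \<omega>) * \<phi> (arrival \<theta> (Suc i) \<omega>) \<partial>M)"
    by (rule nn_integral_renewal_measure[OF renewal]) measurable
  also have "\<dots> = (\<Sum>i. \<integral>\<^sup>+\<omega>. indicator {0..T} (arrival \<theta> (Suc i) \<omega>) * ennreal (weight (Suc i) \<omega> powr \<alpha>) \<partial>M)"
  proof (rule suminf_cong)
    fix i
    define h where "h z = indicator {0..T} (arrival \<theta> (Suc i) (snd z)) *
        ennreal (exp (- \<alpha> * \<xi> (max 0 (arrival \<theta> (Suc i) (snd z))) (fst z)))" for z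
    have arr: "(\<lambda>z. arrival \<theta> (Suc i) (snd z)) \<in> borel_measurable (return_space \<Otimes>\<^sub>M count_process_space)"
      by (rule measurable_compose[OF measurable_snd arrival_count_measurable]) simp
    have "(\<lambda>z. \<xi> (max 0 (arrival \<theta> (Suc i) (snd z))) (fst z)) \<in> borel_measurable (return_space \<Otimes>\<^sub>M count_process_space)"
      using measurable_compose[OF measurable_Pair[OF arr measurable_fst] return_joint_measurable] by simp
    then have h: "h \<in> borel_measurable (return_space \<Otimes>\<^sub>M count_process_space)"
      unfolding h_def[abs_def] using arr by measurable
    have "(\<integral>\<^sup>+\<omega>. indicator {0..T} (arrival \<theta> (Suc i) \<omega>) * \<phi> (arrival \<theta> (Suc i) \<omega>) \<partial>M)
        = (\<integral>\<^sup>+\<omega>2. (\<integral>\<^sup>+\<omega>1. h (\<omega>1, \<omega>2) \<partial>M) \<partial>M)"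
    proof (rule nn_integral_cong)
      fix \<omega>
      have [measurable]: "\<xi> (max 0 (arrival \<theta> (Suc i) \<omega>)) \<in> borel_measurable M" by (rule xi_meas) simp
      show "indicator {0..T} (arrival \<theta> (Suc i) \<omega>) * \<phi> (arrival \<theta> (Suc i) \<omega>) = (\<integral>\<^sup>+\<omega>1. h (\<omega>1, \<omega>) \<partial>M)"
        unfolding \<phi>_def h_def fst_conv snd_conv by (rule nn_integral_cmult[symmetric]) measurable
    qed
    also have "\<dots> = (\<integral>\<^sup>+\<omega>. h (\<omega>, \<omega>) \<partial>M)"
      by (rule indep_set_nn_integral[OF indep_return_count _ _ h, symmetric]) simp_all
    also have "\<dots> = (\<integral>\<^sup>+\<omega>. indicator {0..T} (arrival \<theta> (Suc i) \<omega>) * ennreal (weight (Suc i) \<omega> powr \<alpha>) \<partial>M)"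
      by (intro nn_integral_cong) (simp add: h_def weight_def powr_def)
    finally show "(\<integral>\<^sup>+\<omega>. indicator {0..T} (arrival \<theta> (Suc i) \<omega>) * \<phi> (arrival \<theta> (Suc i) \<omega>) \<partial>M)
        = (\<integral>\<^sup>+\<omega>. indicator {0..T} (arrival \<theta> (Suc i) \<omega>) * ennreal (weight (Suc i) \<omega> powr \<alpha>) \<partial>M)" .
  qed
  also have "\<dots> = (\<integral>\<^sup>+\<omega>. (\<Sum>i. indicator {0..T} (arrival \<theta> (Suc i) \<omega>) * ennreal (weight (Suc i) \<omega> powr \<alpha>)) \<partial>M)"
  proof (rule nn_integral_suminf[symmetric])
    fix i
    have [measurable]: "arrival \<theta> (Suc i) \<in> borel_measurable M" "weight (Suc i) \<in> borel_measurable M"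
      by (simp_all add: measurable_env_M arrival_env_measurable weight_measurable)
    show "(\<lambda>\<omega>. indicator {0..T} (arrival \<theta> (Suc i) \<omega>) * ennreal (weight (Suc i) \<omega> powr \<alpha>)) \<in> borel_measurable M"
      by measurable
  qed
  also have "\<dots> = (\<integral>\<^sup>+\<omega>. ennreal (weight_sum \<alpha> \<omega>) \<partial>M)"
  proof (rule nn_integral_cong_AE)
    show "AE \<omega> in M. (\<Sum>i. indicator {0..T} (arrival \<theta> (Suc i) \<omega>) * ennreal (weight (Suc i) \<omega> powr \<alpha>)) = ennreal (weight_sum \<alpha> \<omega>)"
      using claim_count_finite_AE[OF renewal, of T] AE_space
    proof eventually_elim
      case (elim \<omega>)
      \<comment> \<open>A shift by one: the series starts at index \<open>0\<close>, the claims at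
        number \<open>1\<close>.\<close>
      have iff: "arrival \<theta> (Suc i) \<omega> \<in> {0..T} \<longleftrightarrow> i < claim_number \<omega>" for i
        using le_claim_number_iff[OF elim(2,1), of "Suc i"] arrival_nonneg[OF renewal elim(2)] by (auto simp: Suc_le_eq)
      have "(\<Sum>i. indicator {0..T} (arrival \<theta> (Suc i) \<omega>) * ennreal (weight (Suc i) \<omega> powr \<alpha>))
          = (\<Sum>i<claim_number \<omega>. indicator {0..T} (arrival \<theta> (Suc i) \<omega>) * ennreal (weight (Suc i) \<omega> powr \<alpha>))"
        by (rule suminf_finite) (use iff in \<open>auto simp: indicator_def\<close>)
      also have "\<dots> = (\<Sum>i<claim_number \<omega>. ennreal (weight (Suc i) \<omega> powr \<alpha>))"
        using iff by (intro sum.cong) (auto simp: indicator_def)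
      also have "\<dots> = ennreal (\<Sum>i<claim_number \<omega>. weight (Suc i) \<omega> powr \<alpha>)" by (rule sum_ennreal) simp
      also have "(\<Sum>i<claim_number \<omega>. weight (Suc i) \<omega> powr \<alpha>) = weight_sum \<alpha> \<omega>"
        unfolding weight_sum_def by (simp add: sum.atLeast1_atMost_eq)
      finally show ?case .
    qed
  qed
  also have "enn2real \<dots> = expectation (weight_sum \<alpha>)"
  proof (rule integral_eq_nn_integral[OF weight_sum_measurable, symmetric])
    show "AE \<omega> in M. 0 \<le> weight_sum \<alpha> \<omega>" by (auto simp: weight_sum_def intro!: sum_nonneg)
  qed
  finally show ?thesis unfolding \<psi>_def .
qed

lemma claim_tail_ratio_limit:
  assumes "F \<in> MRV \<alpha> \<mu> G" "0 < \<alpha>"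
  shows "((\<lambda>x. claim_tail x / tail G x) \<longlongrightarrow> quadrant_measure \<mu> A) at_top"
  unfolding claim_tail_def by (rule MRV_reduct_tail[OF A assms(1) sets_F prob_space_F assms(2)])

text \<open>Regular variation of \<open>G\<close> carries over along a ratio of tails with a nonzero
  limit; the quotient splits into three ratios with known limits.\<close>

lemma claim_tail_regularly_varying:
  assumes "F \<in> MRV \<alpha> \<mu> G" "0 < \<alpha>" and c: "quadrant_measure \<mu> A \<noteq> 0" and y: "0 < y"
  shows "((\<lambda>x. claim_tail (y * x) / claim_tail x) \<longlongrightarrow> y powr (-\<alpha>)) at_top"
proof -
  have rv: "regularly_varying \<alpha> G" using assms(1) by (simp add: MRV_def)
  note lim = claim_tail_ratio_limit[OF assms(1,2)]
  have "filterlim (\<lambda>x. y * x) at_top at_top"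
    using y by (intro filterlim_tendsto_pos_mult_at_top[OF tendsto_const] filterlim_ident) auto
  then have "((\<lambda>x. claim_tail (y * x) / tail G (y * x)) \<longlongrightarrow> quadrant_measure \<mu> A) at_top"
    by (rule filterlim_compose[OF lim])
  then have "((\<lambda>x. claim_tail (y * x) / tail G (y * x) * (tail G (y * x) / tail G x) / (claim_tail x / tail G x))
      \<longlongrightarrow> quadrant_measure \<mu> A * y powr (-\<alpha>) / quadrant_measure \<mu> A) at_top"
    by (intro tendsto_divide tendsto_mult lim regularly_varying_ratio[OF rv y] c)
  moreover have "\<forall>\<^sub>F x in at_top. claim_tail (y * x) / tail G (y * x) * (tail G (y * x) / tail G x) / (claim_tail x / tail G x) = claim_tail (y * x) / claim_tail x"
    using eventually_ge_at_top[of 0]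
  proof eventually_elim
    case (elim x)
    then have "0 < tail G (y * x)" "0 < tail G x"
      using rv y by (auto simp: regularly_varying_def halfline_distribution_def)
    then show ?case by simp
  qed
  ultimately show ?thesis using c by (simp add: Lim_transform_eventually)
qed

end

text \<open>Asymptotic equivalence with the zero function would say that the left side vanishes
  eventually, so for \<open>\<mu>(A) = 0\<close> the relation is read as being of smaller order than
  the tail of \<open>G\<close>.\<close>

theorem corollary3p1:
  fixes M :: "'a measure"
    and X :: "nat \<Rightarrow> 'a \<Rightarrow> real ^ 'd"
    and \<theta> :: "nat \<Rightarrow> 'a \<Rightarrow> real"
    and \<xi> :: "real \<Rightarrow> 'a \<Rightarrow> real"
    and F :: "(real ^ 'd) measure"
    and A :: "(real ^ 'd) set"
    and \<mu> :: "(ennreal ^ 'd) measure"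
    and G :: "real measure"
    and \<alpha> T :: real
  assumes "prob_space M"
    and A: "A \<in> class_R"
    and X_meas: "\<And>i. i \<ge> 1 \<Longrightarrow> X i \<in> borel_measurable M"
    and X_distr: "\<And>i. i \<ge> 1 \<Longrightarrow> distr M borel (X i) = F"
    and F_supp: "AE z in F. z \<in> quadrant"
    and F_nonzero: "AE z in F. z \<noteq> 0"
    and renewal: "renewal_interarrivals M \<theta>"
    and xi_meas: "\<And>t. t \<ge> 0 \<Longrightarrow> \<xi> t \<in> borel_measurable M"
    and xi_cadlag: "\<And>\<omega>. \<omega> \<in> space M \<Longrightarrow> cadlag (\<lambda>t. \<xi> t \<omega>)"
    and xi_0: "\<And>\<omega>. \<omega> \<in> space M \<Longrightarrow> \<xi> 0 \<omega> = 0"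
    and indep: "independent_model M X \<theta> \<xi>"
    and xi_lower: "\<And>S. S \<in> finite_horizons M \<theta> \<Longrightarrow>
          \<exists>K>0. measure M {\<omega> \<in> space M. (INF t\<in>{0..S}. ereal (\<xi> t \<omega>)) \<ge> ereal (- K)} = 1"
    and qai: "QAI_on A M X"
    and F_C: "F \<in> class_C A"
    and alpha: "0 < \<alpha>"
    and F_MRV: "F \<in> MRV \<alpha> \<mu> G"
    and T: "T \<in> finite_horizons M \<theta>"
  shows
    "(quadrant_measure \<mu> A \<noteq> 0 \<longrightarrow>
        (\<lambda>x. measure M {\<omega> \<in> space M. discounted_claims X \<theta> \<xi> T \<omega> \<in> (\<lambda>a. x *\<^sub>R a) ` A})
        \<sim>[at_top]
        (\<lambda>x. quadrant_measure \<mu> A * tail G x *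
              (LINT s:{0..T}|renewal_measure M \<theta>. (LINT \<omega>|M. exp (- \<alpha> * \<xi> s \<omega>)))))
     \<and> (quadrant_measure \<mu> A = 0 \<longrightarrow>
        (\<lambda>x. measure M {\<omega> \<in> space M. discounted_claims X \<theta> \<xi> T \<omega> \<in> (\<lambda>a. x *\<^sub>R a) ` A})
        \<in> o[at_top](tail G))"
proof -
  obtain K where K: "0 < K" "measure M {\<omega> \<in> space M. (INF t\<in>{0..T}. ereal (\<xi> t \<omega>)) \<ge> ereal (- K)} = 1"
    using xi_lower[OF T] by blast
  interpret M: prob_space M by fact
  have "AE \<omega> in M. \<omega> \<in> {\<omega> \<in> space M. (INF t\<in>{0..T}. ereal (\<xi> t \<omega>)) \<ge> ereal (- K)}"
    by (rule M.AE_prob_1[OF K(2)])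
  then have "AE \<omega> in M. \<forall>t\<in>{0..T}. - K \<le> \<xi> t \<omega>"
    by eventually_elim (auto simp: le_INF_iff)
  then interpret risk_model M X \<theta> \<xi> F A T K
    using assms K(1) by unfold_locales auto
  define c where "c = quadrant_measure \<mu> A"
  define P where "P x = measure M {\<omega> \<in> space M. discounted_claims X \<theta> \<xi> T \<omega> \<in> (\<lambda>a. x *\<^sub>R a) ` A}" for x
  define L where "L = integral\<^sup>L M (weight_sum \<alpha>)"
  have lim: "((\<lambda>x. claim_tail x / tail G x) \<longlongrightarrow> c) at_top" unfolding c_def by (rule claim_tail_ratio_limit[OF F_MRV alpha])
  have pos: "\<forall>\<^sub>F x in at_top. 0 < tail G x"
    using F_MRV by (auto simp: MRV_def regularly_varying_def halfline_distribution_def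
        intro: eventually_mono[OF eventually_ge_at_top[of 0]])
  have "P \<sim>[at_top] (\<lambda>x. c * tail G x * L)" if c: "c \<noteq> 0"
  proof (rule asymp_equivI')
    have L: "L \<noteq> 0" unfolding L_def using weight_sum_pos[OF alpha] by simp
    have "((\<lambda>x. P x / claim_tail x) \<longlongrightarrow> L) at_top"
      unfolding P_def L_def using prob_discounted_claims_limit[OF claim_tail_regularly_varying[OF F_MRV alpha] qai] c
      by (simp add: c_def)
    then have "((\<lambda>x. P x / claim_tail x * (claim_tail x / tail G x) / (c * L)) \<longlongrightarrow> L * c / (c * L)) at_top"
      using c L by (intro tendsto_divide tendsto_mult lim tendsto_const) auto
    moreover have "\<forall>\<^sub>F x in at_top. P x / claim_tail x * (claim_tail x / tail G x) / (c * L) = P x / (c * tail G x * L)"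
      using pos
    proof eventually_elim
      case (elim x)
      then show ?case using claim_tail_pos[of x] c L by (simp add: field_simps)
    qed
    ultimately have "((\<lambda>x. P x / (c * tail G x * L)) \<longlongrightarrow> L * c / (c * L)) at_top"
      by (rule Lim_transform_eventually)
    then show "((\<lambda>x. P x / (c * tail G x * L)) \<longlongrightarrow> 1) at_top" using c L by simp
  qed
  moreover have "P \<in> o[at_top](tail G)" if c: "c = 0"
  proof (rule smalloI_tendsto)
    \<comment> \<open>The claim tail is itself negligible against \<open>tail G\<close> here, and
      the domination passes this on to \<open>P\<close>.\<close>
    obtain x0 B where B: "\<And>x. x0 \<le> x \<Longrightarrow> P x \<le> B * claim_tail x"
      unfolding P_def using prob_discounted_claims_bound by blast
    have "((\<lambda>x. B * (claim_tail x / tail G x)) \<longlongrightarrow> B * 0) at_top"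
      using lim c by (intro tendsto_mult tendsto_const) simp
    then have upper: "((\<lambda>x. B * (claim_tail x / tail G x)) \<longlongrightarrow> 0) at_top" by simp
    show "((\<lambda>x. P x / tail G x) \<longlongrightarrow> 0) at_top"
    proof (rule tendsto_sandwich[OF _ _ tendsto_const upper])
      show "\<forall>\<^sub>F x in at_top. 0 \<le> P x / tail G x"
        using pos by eventually_elim (simp add: P_def)
      show "\<forall>\<^sub>F x in at_top. P x / tail G x \<le> B * (claim_tail x / tail G x)"
        using pos eventually_ge_at_top[of x0]
        by eventually_elim (use B in \<open>simp add: divide_right_mono\<close>)
    qed
    show "\<forall>\<^sub>F x in at_top. tail G x \<noteq> 0" using pos by eventually_elim simp
  qed
  ultimately show ?thesis
    unfolding renewal_integral[OF alpha] by (simp add: P_def[abs_def] c_def L_def)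
qed

end
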